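(* Let $n\geq 4$ be an integer. Let $\hat{\Delta}_{ws}(n)$ be the clique complex of the graph of weakly separated subsets of $[n]=\{1,\dots,n\}$ with all frozen vertices removed, and let $G=\langle \alpha,w_0\rangle\cong \mathbf{Z}/2\mathbf{Z}\times\mathbf{Z}/2\mathbf{Z}$ act on it by the simplicial symmetries induced by set complementation $\alpha$ and by the reversal $w_0$. Then $\hat{\Delta}_{ws}(n)$ is $G$-contractible.
   Context: Let $[n]=\{1,2,\dots,n\}$. For disjoint $A,B\subset[n]$ write $A\prec B$ if $\max(A)<\min(B)$, i.e. $a<b$ for all $a\in A$, $b\in B$ (this holds vacuously if $A$ or $B$ is empty). For disjoint $A,B$, say that $A$ surrounds $B$ if $A$ can be written as a disjoint union $A=A_1\sqcup A_2$ (parts possibly empty) with $A_1\prec B\prec A_2$. Subsets $A,B\subset[n]$ are weakly separated if at least one of the following holds: (i) $|A|\leq|B|$ and $A\smallsetminus B$ surrounds $B\smallsetminus A$; (ii) $|B|\leq|A|$ and $B\smallsetminus A$ surrounds $A\smallsetminus B$. Consider the graph whose vertices are the subsets of $[n]$, two distinct subsets being adjacent when they are weakly separated. A vertex is frozen if it is weakly separated from every subset of $[n]$; the frozen vertices are exactly the initial and final segments of $[n]$ (sets of the form $\{1,\dots,k\}$ or $\{k,\dots,n\}$, including $\varnothing$ and $[n]$). $\hat{\Delta}_{ws}(n)$ is the clique complex of the graph obtained by deleting the frozen vertices: its vertices are the non-frozen subsets of $[n]$ and its faces are the sets of pairwise weakly separated non-frozen subsets. $\alpha$ sends a subset $A\subset[n]$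 to $[n]\smallsetminus A$, and $w_0$ sends $A$ to $\{n+1-k:k\in A\}$. Both preserve weak separation and hence act simplicially on $\hat{\Delta}_{ws}(n)$. For a group $G$ acting on spaces, a $G$-map is a continuous $G$-equivariant map, $G$-homotopies are homotopies through $G$-maps, and a $G$-space (or the geometric realization of a simplicial complex with simplicial $G$-action) is $G$-contractible if it is $G$-homotopy equivalent to a point. *)

theory Defs
  imports
    "HOL-Analysis.Analysis"
    "HOL-Algebra.Group_Action"
    "HOL-Algebra.Elementary_Groups"
begin

section \<open>Weak separation\<close>

definition precedes :: "nat set \<Rightarrow> nat set \<Rightarrow> bool" where
  "precedes A B \<longleftrightarrow> (\<forall>a\<in>A. \<forall>b\<in>B. a < b)"

definition surrounds :: "nat set \<Rightarrow> nat set \<Rightarrow> bool" where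
  "surrounds A B \<longleftrightarrow>
     (\<exists>A1 A2. A = A1 \<union> A2 \<and> A1 \<inter> A2 = {} \<and> precedes A1 B \<and> precedes B A2)"

definition weakly_separated :: "nat set \<Rightarrow> nat set \<Rightarrow> bool" where
  "weakly_separated A B \<longleftrightarrow>
     (card A \<le> card B \<and> surrounds (A - B) (B - A)) \<or>
     (card B \<le> card A \<and> surrounds (B - A) (A - B))"

definition frozen :: "nat \<Rightarrow> nat set \<Rightarrow> bool" where
  "frozen n A \<longleftrightarrow> A \<subseteq> {1..n} \<and> (\<forall>B. B \<subseteq> {1..n} \<longrightarrow> weakly_separated A B)"

section \<open>Abstract simplicial complexes and their geometric realization\<close>

text \<open>A complex is given by its set of faces; the empty face is allowed and does not
  contribute to the realization.  \<open>pairwise\<close> only compares distinct elements.\<close>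

definition clique_complex :: "'v set \<Rightarrow> ('v \<Rightarrow> 'v \<Rightarrow> bool) \<Rightarrow> 'v set set" where
  "clique_complex V E = {F. finite F \<and> F \<subseteq> V \<and> pairwise E F}"

text \<open>Points are given by barycentric coordinates, extended by zero to all of \<open>'v\<close>.\<close>

definition realization_points :: "'v set set \<Rightarrow> ('v \<Rightarrow> real) set" where
  "realization_points K =
     {x. (\<forall>v. 0 \<le> x v) \<and> {v. x v \<noteq> 0} \<in> K \<and> (\<Sum>v | x v \<noteq> 0. x v) = 1}"

text \<open>The topology is that of pointwise convergence of the coordinates (the topology on
  functions is the product topology).  For a complex with finitely many vertices, the only
  case used here, this is the usual topology of a compact polyhedron, and it agrees with the
  weak topology.\<close>

definition realization :: "'v set set \<Rightarrow> ('v \<Rightarrow> real) topology" where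
  "realization K = top_of_set (realization_points K)"

text \<open>The map of realizations induced by a simplicial self-map \<open>f\<close> of \<open>K\<close>, affine on each
  simplex: the coordinate of the image at \<open>w\<close> is the total weight of the vertices that \<open>f\<close>
  sends to \<open>w\<close>.  It is made extensional so as to fit \<open>BijGroup\<close>.\<close>

definition realization_map :: "'v set set \<Rightarrow> ('v \<Rightarrow> 'v) \<Rightarrow> ('v \<Rightarrow> real) \<Rightarrow> ('v \<Rightarrow> real)" where
  "realization_map K f =
     (\<lambda>x \<in> realization_points K. \<lambda>w. \<Sum>v | x v \<noteq> 0 \<and> f v = w. x v)"

section \<open>Spaces with a group action\<close>

definition G_space :: "('g, 'm) monoid_scheme \<Rightarrow> 'x topology \<Rightarrow> ('g \<Rightarrow> 'x \<Rightarrow> 'x) \<Rightarrow> bool" where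
  "G_space G X \<phi> \<longleftrightarrow>
     group_action G (topspace X) \<phi> \<and> (\<forall>g\<in>carrier G. continuous_map X X (\<phi> g))"

definition equivariant ::
  "('g, 'm) monoid_scheme \<Rightarrow> 'x topology \<Rightarrow> ('g \<Rightarrow> 'x \<Rightarrow> 'x) \<Rightarrow> ('g \<Rightarrow> 'y \<Rightarrow> 'y) \<Rightarrow> ('x \<Rightarrow> 'y) \<Rightarrow> bool" where
  "equivariant G X \<phi> \<psi> f \<longleftrightarrow>
     (\<forall>g\<in>carrier G. \<forall>x\<in>topspace X. f (\<phi> g x) = \<psi> g (f x))"

definition G_map ::
  "('g, 'm) monoid_scheme \<Rightarrow> 'x topology \<Rightarrow> ('g \<Rightarrow> 'x \<Rightarrow> 'x) \<Rightarrow> 'y topology \<Rightarrow> ('g \<Rightarrow> 'y \<Rightarrow> 'y) \<Rightarrow>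
   ('x \<Rightarrow> 'y) \<Rightarrow> bool" where
  "G_map G X \<phi> Y \<psi> f \<longleftrightarrow> continuous_map X Y f \<and> equivariant G X \<phi> \<psi> f"

definition G_homotopic ::
  "('g, 'm) monoid_scheme \<Rightarrow> 'x topology \<Rightarrow> ('g \<Rightarrow> 'x \<Rightarrow> 'x) \<Rightarrow> 'y topology \<Rightarrow> ('g \<Rightarrow> 'y \<Rightarrow> 'y) \<Rightarrow>
   ('x \<Rightarrow> 'y) \<Rightarrow> ('x \<Rightarrow> 'y) \<Rightarrow> bool" where
  "G_homotopic G X \<phi> Y \<psi> = homotopic_with (equivariant G X \<phi> \<psi>) X Y"

definition G_homotopy_equivalent ::
  "('g, 'm) monoid_scheme \<Rightarrow> 'x topology \<Rightarrow> ('g \<Rightarrow> 'x \<Rightarrow> 'x) \<Rightarrow> 'y topology \<Rightarrow> ('g \<Rightarrow> 'y \<Rightarrow> 'y) \<Rightarrow>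
   bool" where
  "G_homotopy_equivalent G X \<phi> Y \<psi> \<longleftrightarrow>
     (\<exists>f h. G_map G X \<phi> Y \<psi> f \<and> G_map G Y \<psi> X \<phi> h \<and>
            G_homotopic G X \<phi> X \<phi> (h \<circ> f) id \<and>
            G_homotopic G Y \<psi> Y \<psi> (f \<circ> h) id)"

definition G_contractible :: "('g, 'm) monoid_scheme \<Rightarrow> 'x topology \<Rightarrow> ('g \<Rightarrow> 'x \<Rightarrow> 'x) \<Rightarrow> bool" where
  "G_contractible G X \<phi> \<longleftrightarrow>
     G_space G X \<phi> \<and>
     G_homotopy_equivalent G X \<phi> (discrete_topology {()}) (\<lambda>g x. x)"

section \<open>The complex and its symmetry group\<close>

definition Delta_ws_hat :: "nat \<Rightarrow> nat set set set" where
  "Delta_ws_hat n = clique_complex {A. A \<subseteq> {1..n} \<and> \<not> frozen n A} weakly_separated"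

definition alpha :: "nat \<Rightarrow> nat set \<Rightarrow> nat set" where
  "alpha n = (\<lambda>A \<in> Pow {1..n}. {1..n} - A)"

definition w0 :: "nat \<Rightarrow> nat set \<Rightarrow> nat set" where
  "w0 n = (\<lambda>A \<in> Pow {1..n}. (\<lambda>k. n + 1 - k) ` A)"

definition sym_group :: "nat \<Rightarrow> (nat set \<Rightarrow> nat set) monoid" where
  "sym_group n = subgroup_generated (BijGroup (Pow {1..n})) {alpha n, w0 n}"

definition sym_action ::
  "nat \<Rightarrow> (nat set \<Rightarrow> nat set) \<Rightarrow> (nat set \<Rightarrow> real) \<Rightarrow> (nat set \<Rightarrow> real)" where
  "sym_action n g = realization_map (Delta_ws_hat n) g"


section \<open>Well-definedness\<close>

context
  notes One_nat_def [simp del]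
begin

lemma frozen_iff:
  "frozen n A \<longleftrightarrow> (\<exists>k\<le>n. A = {1..k} \<or> A = {k+1..n})"
proof
  assume fr: "frozen n A"
  then have An: "A \<subseteq> {1..n}" and ws: "\<And>B. B \<subseteq> {1..n} \<Longrightarrow> weakly_separated A B"
    by (auto simp: frozen_def)
  have fin: "finite A" using An finite_subset by blast
  have ioi: False if "a \<in> A" "b \<notin> A" "c \<in> A" "b \<in> {1..n}" "a < b" "b < c" for a b c
  proof -
    let ?B = "insert b (A - {a,c})"
    have "card {a,c} \<le> card A"
      using that fin by (intro card_mono) auto
    moreover have "card ?B = Suc (card (A - {a,c}))" using fin that by simp
    moreover have "card (A - {a,c}) = card A - 2"
      using that fin by (subst card_Diff_subset) auto
    ultimately have "card ?B < card A" using that by simp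
    moreover have "A - ?B = {a,c}" "?B - A = {b}" using that by auto
    moreover have "weakly_separated A ?B" using An that by (intro ws) auto
    ultimately have "surrounds {b} {a,c}" by (auto simp: weakly_separated_def)
    then obtain A1 A2 where "{b} = A1 \<union> A2" "precedes A1 {a,c}" "precedes {a,c} A2"
      by (auto simp: surrounds_def)
    moreover from this have "b \<in> A1 \<or> b \<in> A2" by blast
    ultimately show False using that by (auto simp: precedes_def)
  qed
  have oio: False if "a \<notin> A" "b \<in> A" "c \<notin> A" "a \<in> {1..n}" "c \<in> {1..n}" "a < b" "b < c" for a b c
  proof -
    let ?B = "insert a (insert c (A - {b}))"
    have "card ?B = card (A - {b}) + 2" using fin that by simp
    then have "card A < card ?B" using that fin by simp
    moreover have "A - ?B = {b}" "?B - A = {a,c}" using that by auto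
    moreover have "weakly_separated A ?B" using An that by (intro ws) auto
    ultimately have "surrounds {b} {a,c}" by (auto simp: weakly_separated_def)
    then obtain A1 A2 where "{b} = A1 \<union> A2" "precedes A1 {a,c}" "precedes {a,c} A2"
      by (auto simp: surrounds_def)
    moreover from this have "b \<in> A1 \<or> b \<in> A2" by blast
    ultimately show False using that by (auto simp: precedes_def)
  qed
  show "\<exists>k\<le>n. A = {1..k} \<or> A = {k+1..n}"
  proof (cases "A = {}")
    case True
    then show ?thesis by (intro exI[of _ 0]) auto
  next
    case False
    consider (init) "\<And>i j. i \<in> {1..n} \<Longrightarrow> i \<notin> A \<Longrightarrow> j \<in> A \<Longrightarrow> \<not> i < j"
      | (fin) "\<And>k l. l \<in> {1..n} \<Longrightarrow> l \<notin> A \<Longrightarrow> k \<in> A \<Longrightarrow> \<not> k < l"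
      | (bad) i j k l where "i \<in> {1..n}" "i \<notin> A" "j \<in> A" "i < j" "l \<in> {1..n}" "l \<notin> A" "k \<in> A" "k < l"
      by metis
    then show ?thesis
    proof cases
      case init
      have "A = {1..Max A}"
      proof (intro equalityI subsetI)
        fix x assume "x \<in> A" then show "x \<in> {1..Max A}" using An fin by auto
      next
        fix x assume x: "x \<in> {1..Max A}"
        have M: "Max A \<in> A" using fin False by simp
        show "x \<in> A"
          using init[of x "Max A"] M An x by (cases "x = Max A") fastforce+
      qed
      moreover have "Max A \<le> n" using An fin False Max_in by fastforce
      ultimately show ?thesis by blast
    next
      case fin
      have M: "Min A \<in> A" using \<open>finite A\<close> False by simp
      then have M1: "1 \<le> Min A" "Min A \<le> n" using An by auto
      have "A = {Min A..n}"
      proof (intro equalityI subsetI)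
        fix x assume "x \<in> A" then show "x \<in> {Min A..n}" using An \<open>finite A\<close> by auto
      next
        fix x assume x: "x \<in> {Min A..n}"
        show "x \<in> A"
          using fin[of x "Min A"] M M1 x by (cases "x = Min A") fastforce+
      qed
      then have "A = {(Min A - 1) + 1..n}" using M1 by simp
      moreover have "Min A - 1 \<le> n" using M1 by simp
      ultimately show ?thesis by blast
    next
      case bad
      have "j \<noteq> l" using bad by auto
      then show ?thesis
        using oio[of i j l] ioi[of k l j] bad by (cases "j < l") auto
    qed
  qed
next
  have triv: "surrounds X Y" if "precedes X Y \<or> precedes Y X" for X Y
    using that unfolding surrounds_def precedes_def
    by (metis Int_empty_left Int_empty_right Un_empty_left Un_empty_right empty_iff)
  have 1: "weakly_separated X Y" if "precedes (X - Y) (Y - X) \<or> precedes (Y - X) (X - Y)" for X Y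
    using that triv unfolding weakly_separated_def by (meson nle_le)
  assume "\<exists>k\<le>n. A = {1..k} \<or> A = {k+1..n}"
  then show "frozen n A"
    unfolding frozen_def by (auto intro!: 1 simp: precedes_def subset_iff)
qed

lemma weakly_separated_commute: "weakly_separated A B \<longleftrightarrow> weakly_separated B A"
  by (auto simp: weakly_separated_def)

lemma alpha_Bij: "alpha n \<in> Bij (Pow {1..n})"
proof -
  have "bij_betw (alpha n) (Pow {1..n}) (Pow {1..n})"
    by (rule bij_betw_byWitness[where f' = "alpha n"]) (auto simp: alpha_def)
  then show ?thesis by (simp add: Bij_def alpha_def)
qed

lemma mem_w0:
  assumes "A \<subseteq> {1..n}"
  shows "x \<in> w0 n A \<longleftrightarrow> x \<in> {1..n} \<and> n + 1 - x \<in> A"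
proof
  assume "x \<in> w0 n A"
  then obtain k where "k \<in> A" "x = n + 1 - k" using assms by (auto simp: w0_def)
  moreover from this have "1 \<le> k" "k \<le> n" using assms by auto
  ultimately show "x \<in> {1..n} \<and> n + 1 - x \<in> A" by auto
next
  assume x: "x \<in> {1..n} \<and> n + 1 - x \<in> A"
  then have "x = n + 1 - (n + 1 - x)" by auto
  with x have "x \<in> (\<lambda>k. n + 1 - k) ` A" by (metis imageI)
  then show "x \<in> w0 n A" using assms by (simp add: w0_def)
qed

lemma w0_in: "A \<subseteq> {1..n} \<Longrightarrow> w0 n A \<subseteq> {1..n}"
  using mem_w0 by blast

lemma w0_w0:
  assumes "A \<subseteq> {1..n}"
  shows "w0 n (w0 n A) = A"
proof (rule Set.set_eqI)
  fix x
  have "n + 1 - x \<in> {1..n}" "n + 1 - (n + 1 - x) = x" if "x \<in> {1..n}" using that by auto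
  then show "x \<in> w0 n (w0 n A) \<longleftrightarrow> x \<in> A"
    using assms mem_w0[OF assms] mem_w0[OF w0_in[OF assms]] by (metis subsetD)
qed

lemma alpha_alpha: "A \<subseteq> {1..n} \<Longrightarrow> alpha n (alpha n A) = A"
  by (auto simp: alpha_def)

lemma alpha_in: "A \<subseteq> {1..n} \<Longrightarrow> alpha n A \<subseteq> {1..n}"
  by (auto simp: alpha_def)

lemma mem_alpha: "A \<subseteq> {1..n} \<Longrightarrow> x \<in> alpha n A \<longleftrightarrow> x \<in> {1..n} \<and> x \<notin> A"
  by (auto simp: alpha_def)

lemma w0_alpha:
  assumes "A \<subseteq> {1..n}"
  shows "w0 n (alpha n A) = alpha n (w0 n A)"
proof (rule Set.set_eqI)
  fix x
  have "n + 1 - x \<in> {1..n}" if "x \<in> {1..n}" using that by auto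
  then show "x \<in> w0 n (alpha n A) \<longleftrightarrow> x \<in> alpha n (w0 n A)"
    using mem_w0[OF assms] mem_w0[OF alpha_in[OF assms]] mem_alpha[OF assms]
      mem_alpha[OF w0_in[OF assms]] by metis
qed

lemma w0_Bij: "w0 n \<in> Bij (Pow {1..n})"
proof -
  have "bij_betw (w0 n) (Pow {1..n}) (Pow {1..n})"
    by (rule bij_betw_byWitness[where f' = "w0 n"]) (use w0_in in \<open>auto simp: w0_w0\<close>)
  then show ?thesis by (simp add: Bij_def w0_def)
qed

lemma surrounds_w0:
  assumes "A \<subseteq> {1..n}" "B \<subseteq> {1..n}" "surrounds A B"
  shows "surrounds (w0 n A) (w0 n B)"
proof -
  obtain A1 A2 where A: "A = A1 \<union> A2" "A1 \<inter> A2 = {}" "precedes A1 B" "precedes B A2"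
    using assms by (auto simp: surrounds_def)
  with assms have s: "A1 \<subseteq> {1..n}" "A2 \<subseteq> {1..n}" by auto
  have "w0 n A = w0 n A2 \<union> w0 n A1" "w0 n A2 \<inter> w0 n A1 = {}"
    using A(1,2) mem_w0[OF s(1)] mem_w0[OF s(2)] mem_w0[OF assms(1)] by blast+
  moreover have rev: "precedes (w0 n Y) (w0 n X)"
    if "precedes X Y" "X \<subseteq> {1..n}" "Y \<subseteq> {1..n}" for X Y
    unfolding precedes_def
  proof (intro ballI)
    fix a b assume "a \<in> w0 n Y" "b \<in> w0 n X"
    then have "n + 1 - b < n + 1 - a"
      using that mem_w0[OF that(2)] mem_w0[OF that(3)] unfolding precedes_def by blast
    then show "a < b" by simp
  qed
  moreover have "precedes (w0 n A2) (w0 n B)" "precedes (w0 n B) (w0 n A1)"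
    using rev A(3,4) s assms by blast+
  ultimately show ?thesis unfolding surrounds_def by blast
qed

lemma card_w0:
  assumes "A \<subseteq> {1..n}"
  shows "card (w0 n A) = card A"
proof -
  have "inj_on (\<lambda>k. n + 1 - k) {1..n}" by (auto intro!: inj_onI)
  then have "card ((\<lambda>k. n + 1 - k) ` A) = card A"
    using assms by (intro card_image) (rule inj_on_subset)
  then show ?thesis using assms by (simp add: w0_def)
qed

lemma weakly_separated_w0:
  assumes "A \<subseteq> {1..n}" "B \<subseteq> {1..n}" "weakly_separated A B"
  shows "weakly_separated (w0 n A) (w0 n B)"
proof -
  have "w0 n A - w0 n B = w0 n (A - B)" "w0 n B - w0 n A = w0 n (B - A)"
    using mem_w0[OF assms(1)] mem_w0[OF assms(2)] mem_w0[of "A - B" n] mem_w0[of "B - A" n] assms(1,2)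
    by blast+
  then show ?thesis
    using assms surrounds_w0[of "A - B" n "B - A"] surrounds_w0[of "B - A" n "A - B"]
    by (auto simp: weakly_separated_def card_w0)
qed

lemma weakly_separated_alpha:
  assumes "A \<subseteq> {1..n}" "B \<subseteq> {1..n}" "weakly_separated A B"
  shows "weakly_separated (alpha n A) (alpha n B)"
proof -
  have "alpha n A - alpha n B = B - A" "alpha n B - alpha n A = A - B"
    using assms by (auto simp: alpha_def)
  moreover have "card (alpha n A) = n - card A" "card (alpha n B) = n - card B"
    using assms by (auto simp: alpha_def card_Diff_subset finite_subset)
  ultimately show ?thesis
    using assms by (auto simp: weakly_separated_def)
qed

lemma compose_sym_group:
  fixes n :: nat
  defines "S \<equiv> Pow {1..n}"
  defines "i \<equiv> (\<lambda>A\<in>S. A)" and "a \<equiv> alpha n" and "w \<equiv> w0 n"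
  defines "c \<equiv> compose S a w"
  shows "compose S a a = i" "compose S w w = i" "compose S c c = i" "compose S i i = i"
    "compose S w a = c" "compose S a c = w" "compose S w c = a"
    "compose S c a = w" "compose S c w = a" "compose S i a = a" "compose S a i = a"
    "compose S i w = w" "compose S w i = w" "compose S i c = c" "compose S c i = c"
proof -
  have ext: "i \<in> extensional S" "a \<in> extensional S" "w \<in> extensional S" "c \<in> extensional S"
    using Bij_imp_extensional[OF alpha_Bij[of n]] Bij_imp_extensional[OF w0_Bij[of n]]
    by (auto simp: i_def a_def w_def c_def S_def compose_extensional)
  have v: "a A \<in> S" "w A \<in> S" "a (a A) = A" "w (w A) = A" "w (a A) = a (w A)" "i A = A" "c A = a (w A)"
    if "A \<in> S" for A
    using that alpha_in w0_in alpha_alpha w0_w0 w0_alpha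
    by (auto simp only: S_def a_def w_def i_def c_def Pow_iff restrict_apply' compose_eq)
  note * = extensionalityI[OF compose_extensional _, of _ S]
  show "compose S a a = i" "compose S w w = i" "compose S c c = i" "compose S i i = i"
    "compose S w a = c" "compose S a c = w" "compose S w c = a"
    "compose S c a = w" "compose S c w = a" "compose S i a = a" "compose S a i = a"
    "compose S i w = w" "compose S w i = w" "compose S i c = c" "compose S c i = c"
    by (rule *; simp add: ext compose_eq v)+
qed

lemma carrier_sym_group:
  "carrier (sym_group n) =
     {\<lambda>A\<in>Pow {1..n}. A, alpha n, w0 n, compose (Pow {1..n}) (alpha n) (w0 n)}"
  (is "_ = ?R")
proof -
  let ?S = "Pow {1..n}" and ?B = "BijGroup (Pow {1..n})"
  interpret B: group ?B by (rule group_BijGroup)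
  have c: "alpha n \<in> carrier ?B" "w0 n \<in> carrier ?B"
    by (auto simp: BijGroup_def alpha_Bij w0_Bij)
  have RB: "?R \<subseteq> Bij ?S"
    using alpha_Bij w0_Bij by (auto intro: id_Bij compose_Bij)
  have cl: "compose ?S f g \<in> ?R" if "f \<in> ?R" "g \<in> ?R" for f g
  proof -
    from that show ?thesis by (elim insertE emptyE) (simp_all add: compose_sym_group)
  qed
  have inv: "\<exists>g\<in>?R. compose ?S g f = (\<lambda>A\<in>?S. A)" if "f \<in> ?R" for f
  proof -
    have "compose ?S f f = (\<lambda>A\<in>?S. A)"
      using that by (elim insertE emptyE) (simp_all add: compose_sym_group)
    with that show ?thesis by blast
  qed
  have sub: "subgroup ?R ?B"
  proof (rule B.subgroupI)
    show "?R \<subseteq> carrier ?B" using RB by (simp add: BijGroup_def)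
    show "?R \<noteq> {}" by blast
    fix f assume f: "f \<in> ?R"
    then obtain g where g: "g \<in> ?R" "compose ?S g f = (\<lambda>A\<in>?S. A)" using inv by blast
    have fg: "f \<in> Bij ?S" "g \<in> Bij ?S" using f g RB by blast+
    have "inv\<^bsub>?B\<^esub> f = g"
      by (rule B.inv_equality) (use fg g in \<open>auto simp: BijGroup_def\<close>)
    then show "inv\<^bsub>?B\<^esub> f \<in> ?R" using g by simp
    fix h assume h: "h \<in> ?R"
    then have hB: "h \<in> Bij ?S" using RB by blast
    have "f \<otimes>\<^bsub>?B\<^esub> h = compose ?S f h" using hB fg by (simp add: BijGroup_def)
    then show "f \<otimes>\<^bsub>?B\<^esub> h \<in> ?R" using cl f h by simp
  qed
  have gen: "generate ?B {alpha n, w0 n} = ?R"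
  proof
    show "generate ?B {alpha n, w0 n} \<subseteq> ?R"
      by (rule B.generate_subgroup_incl[OF _ sub]) auto
    have a: "alpha n \<in> generate ?B {alpha n, w0 n}" "w0 n \<in> generate ?B {alpha n, w0 n}"
      by (auto intro: generate.incl)
    moreover have "(\<lambda>A\<in>?S. A) \<in> generate ?B {alpha n, w0 n}"
      using generate.one[of ?B "{alpha n, w0 n}"] by (simp add: BijGroup_def)
    moreover have "compose ?S (alpha n) (w0 n) \<in> generate ?B {alpha n, w0 n}"
      using generate.eng[OF a] alpha_Bij w0_Bij by (simp add: BijGroup_def)
    ultimately show "?R \<subseteq> generate ?B {alpha n, w0 n}" by auto
  qed
  show ?thesis using c gen by (simp add: sym_group_def carrier_subgroup_generated)
qed

lemma group_sym_group: "group (sym_group n)"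
  by (simp add: sym_group_def group.group_subgroup_generated group_BijGroup)

lemma sym_group_Bij: "g \<in> carrier (sym_group n) \<Longrightarrow> g \<in> Bij (Pow {1..n})"
  using alpha_Bij w0_Bij by (auto simp: carrier_sym_group intro: id_Bij compose_Bij)

lemma mult_sym_group:
  "f \<in> carrier (sym_group n) \<Longrightarrow> g \<in> carrier (sym_group n) \<Longrightarrow>
   f \<otimes>\<^bsub>sym_group n\<^esub> g = compose (Pow {1..n}) f g"
  using sym_group_Bij[of f n] sym_group_Bij[of g n]
  by (simp add: sym_group_def subgroup_generated_def BijGroup_def)

lemma one_sym_group: "\<one>\<^bsub>sym_group n\<^esub> = (\<lambda>A\<in>Pow {1..n}. A)"
  by (simp add: sym_group_def subgroup_generated_def BijGroup_def)

lemma sym_group_involution: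
  "g \<in> carrier (sym_group n) \<Longrightarrow> compose (Pow {1..n}) g g = (\<lambda>A\<in>Pow {1..n}. A)"
  unfolding carrier_sym_group by (elim insertE emptyE) (simp_all add: compose_sym_group)

lemma sym_group_app:
  assumes "g \<in> carrier (sym_group n)" "A \<subseteq> {1..n}"
  shows "g A \<subseteq> {1..n}" "g (g A) = A"
proof -
  show "g A \<subseteq> {1..n}"
    using Bij_imp_funcset[OF sym_group_Bij[OF assms(1)]] assms(2) by blast
  show "g (g A) = A"
    using fun_cong[OF sym_group_involution[OF assms(1)], of A] assms(2) by (simp add: compose_eq)
qed

lemma sym_group_iso:
  assumes "n \<ge> 3"
  shows "sym_group n \<cong> integer_mod_group 2 \<times>\<times> integer_mod_group 2"
proof -
  let ?S = "Pow {1..n}"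
  define i where "i = (\<lambda>A\<in>?S. A)"
  define c where "c = compose ?S (alpha n) (w0 n)"
  have in1: "{1} \<in> ?S" and in0: "{} \<in> ?S" using assms by auto
  have v: "i {} = {}" "alpha n {} = {1..n}" "w0 n {} = {}" "c {} = {1..n}"
    by (auto simp: i_def alpha_def w0_def c_def compose_def)
  have v1: "i {1} = {1}" "w0 n {1} = {n}" "alpha n {1} = {1..n} - {1}" "c {1} = {1..n} - {n}"
    using assms by (auto simp: i_def w0_def alpha_def c_def compose_def)
  have "{1..n} \<noteq> {}" "{1} \<noteq> {n}" using assms by auto
  moreover have "{1..n} - {1} \<noteq> {1..n} - {n}"
  proof -
    have "n \<in> {1..n} - {1}" "n \<notin> {1..n} - {n}" using assms by auto
    then show ?thesis by metis
  qed
  ultimately have d: "i \<noteq> alpha n" "i \<noteq> w0 n" "i \<noteq> c" "alpha n \<noteq> w0 n" "alpha n \<noteq> c" "w0 n \<noteq> c"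
    using v v1 by metis+
  have car: "carrier (sym_group n) = {i, alpha n, w0 n, c}"
    by (simp add: carrier_sym_group i_def c_def)
  have e: "compose ?S (alpha n) (alpha n) = i"
    "compose ?S (w0 n) (w0 n) = i" "compose ?S c c = i" "compose ?S i i = i"
    "compose ?S (w0 n) (alpha n) = c"
    "compose ?S (alpha n) c = w0 n" "compose ?S (w0 n) c = alpha n"
    "compose ?S c (alpha n) = w0 n" "compose ?S c (w0 n) = alpha n"
    "compose ?S i (alpha n) = alpha n" "compose ?S (alpha n) i = alpha n"
    "compose ?S i (w0 n) = w0 n" "compose ?S (w0 n) i = w0 n"
    "compose ?S i c = c" "compose ?S c i = c"
    unfolding i_def c_def by (fact compose_sym_group)+
  define h :: "(nat set \<Rightarrow> nat set) \<Rightarrow> int \<times> int" where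
    "h g = (if g = alpha n \<or> g = c then 1 else 0, if g = w0 n \<or> g = c then 1 else 0)" for g
  have hv: "h i = (0,0)" "h (alpha n) = (1,0)" "h (w0 n) = (0,1)" "h c = (1,1)"
    using d d[symmetric] by (auto simp: h_def)
  have car2: "carrier (integer_mod_group 2) = {0,1}"
    by (auto simp: carrier_integer_mod_group)
  have "h \<in> hom (sym_group n) (integer_mod_group 2 \<times>\<times> integer_mod_group 2)"
  proof (rule homI)
    fix g assume "g \<in> carrier (sym_group n)"
    then show "h g \<in> carrier (integer_mod_group 2 \<times>\<times> integer_mod_group 2)"
      by (auto simp: car hv car2 DirProd_def)
  next
    fix f g assume fg: "f \<in> carrier (sym_group n)" "g \<in> carrier (sym_group n)"
    then have "h (compose ?S f g) = h f \<otimes>\<^bsub>integer_mod_group 2 \<times>\<times> integer_mod_group 2\<^esub> h g"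
      unfolding car by (elim insertE emptyE) (simp_all add: e hv DirProd_def flip: c_def)
    then show "h (f \<otimes>\<^bsub>sym_group n\<^esub> g) = h f \<otimes>\<^bsub>integer_mod_group 2 \<times>\<times> integer_mod_group 2\<^esub> h g"
      using fg by (simp add: mult_sym_group)
  qed
  moreover have "bij_betw h (carrier (sym_group n)) (carrier (integer_mod_group 2 \<times>\<times> integer_mod_group 2))"
    unfolding bij_betw_def inj_on_def car by (auto simp: hv car2 DirProd_def)
  ultimately show ?thesis unfolding is_iso_def iso_def by blast
qed

end

lemma finite_support: "x \<in> realization_points K \<Longrightarrow> finite {v. x v \<noteq> 0}"
  by (rule ccontr) (simp add: realization_points_def)

lemma support_realization_map:
  assumes "x \<in> realization_points K"
  shows "{w. realization_map K f x w \<noteq> 0} = f ` {v. x v \<noteq> 0}"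
proof -
  have fin: "finite {v. x v \<noteq> 0 \<and> f v = w}" for w
    using finite_support[OF assms] by (rule rev_finite_subset) auto
  have "0 \<le> x v" for v using assms by (simp add: realization_points_def)
  then have "(\<Sum>v | x v \<noteq> 0 \<and> f v = w. x v) = 0 \<longleftrightarrow> {v. x v \<noteq> 0 \<and> f v = w} = {}" for w
    by (subst sum_nonneg_eq_0_iff[OF fin]) auto
  then show ?thesis using assms by (auto simp: realization_map_def)
qed

lemma realization_map_in:
  assumes "x \<in> realization_points K" "\<And>F. F \<in> K \<Longrightarrow> f ` F \<in> K"
  shows "realization_map K f x \<in> realization_points K"
proof -
  have x: "\<And>v. 0 \<le> x v" "{v. x v \<noteq> 0} \<in> K" "(\<Sum>v | x v \<noteq> 0. x v) = 1"
    using assms by (auto simp: realization_points_def)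
  have "0 \<le> realization_map K f x w" for w
    using x(1) assms(1) by (simp add: realization_map_def sum_nonneg)
  moreover have "(\<Sum>w\<in>f ` {v. x v \<noteq> 0}. realization_map K f x w) = 1"
    using x(3) sum.image_gen[OF finite_support[OF assms(1)], of x f] assms(1)
    by (simp add: realization_map_def)
  ultimately show ?thesis
    using x(2) assms unfolding realization_points_def[of K]
    by (auto simp: support_realization_map[OF assms(1)] simp del: mem_Collect_eq intro: CollectI)
qed

lemma realization_map_compose:
  assumes "x \<in> realization_points K" "\<And>F. F \<in> K \<Longrightarrow> f ` F \<in> K" "\<Union>K \<subseteq> S"
  shows "realization_map K g (realization_map K f x) = realization_map K (compose S g f) x"
proof
  fix w
  have K: "{v. x v \<noteq> 0} \<in> K" using assms by (simp add: realization_points_def)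
  have supp: "{u. realization_map K f x u \<noteq> 0 \<and> g u = w} = f ` {v. x v \<noteq> 0 \<and> g (f v) = w}"
    using support_realization_map[OF assms(1), of f] by (auto simp: set_eq_iff image_iff)
  have fin: "finite {v. x v \<noteq> 0 \<and> g (f v) = w}"
    using finite_support[OF assms(1)] by (rule rev_finite_subset) auto
  have "realization_map K g (realization_map K f x) w =
      (\<Sum>u\<in>f ` {v. x v \<noteq> 0 \<and> g (f v) = w}. realization_map K f x u)"
    using realization_map_in[OF assms(1,2)] supp by (simp add: realization_map_def[of K g])
  also have "\<dots> = (\<Sum>u\<in>f ` {v. x v \<noteq> 0 \<and> g (f v) = w}. \<Sum>v | v \<in> {v. x v \<noteq> 0 \<and> g (f v) = w} \<and> f v = u. x v)"
    using assms(1) by (intro sum.cong) (auto simp: realization_map_def intro!: sum.cong)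
  also have "\<dots> = (\<Sum>v | x v \<noteq> 0 \<and> g (f v) = w. x v)"
    using sum.image_gen[OF fin, of x f] by simp
  also have "\<dots> = realization_map K (compose S g f) x w"
    using K assms by (auto simp: realization_map_def compose_def intro!: sum.cong)
  finally show "realization_map K g (realization_map K f x) w = realization_map K (compose S g f) x w" .
qed

lemma realization_map_id:
  assumes "\<Union>K \<subseteq> S"
  shows "realization_map K (\<lambda>v\<in>S. v) = (\<lambda>x\<in>realization_points K. x)"
proof
  fix x
  show "realization_map K (\<lambda>v\<in>S. v) x = (\<lambda>x\<in>realization_points K. x) x"
  proof (cases "x \<in> realization_points K")
    case True
    then have K: "{v. x v \<noteq> 0} \<in> K" by (simp add: realization_points_def)
    have "{v. x v \<noteq> 0 \<and> (\<lambda>v\<in>S. v) v = w} = (if x w \<noteq> 0 then {w} else {})" for w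
      using K assms by (auto simp: restrict_def split: if_splits)
    then show ?thesis using True by (auto simp: realization_map_def fun_eq_iff)
  qed (simp add: realization_map_def)
qed

lemma continuous_realization_map:
  assumes "finite (\<Union>K)" "\<And>F. F \<in> K \<Longrightarrow> f ` F \<in> K"
  shows "continuous_map (realization K) (realization K) (realization_map K f)"
proof -
  have eq: "realization_map K f x w = (\<Sum>v | v \<in> \<Union>K \<and> f v = w. x v)"
    if "x \<in> realization_points K" for x w
  proof -
    have "{v. x v \<noteq> 0} \<in> K" using that by (simp add: realization_points_def)
    then have "{v. x v \<noteq> 0 \<and> f v = w} \<subseteq> {v. v \<in> \<Union>K \<and> f v = w}" by blast
    moreover have "finite {v. v \<in> \<Union>K \<and> f v = w}"
      using assms(1) by (rule rev_finite_subset) auto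
    ultimately have "(\<Sum>v | x v \<noteq> 0 \<and> f v = w. x v) = (\<Sum>v | v \<in> \<Union>K \<and> f v = w. x v)"
      by (intro sum.mono_neutral_left) auto
    then show ?thesis using that by (simp add: realization_map_def)
  qed
  have c: "continuous_on S (\<lambda>x::'a \<Rightarrow> real. x v)" for v S
    using continuous_on_product_coordinates[of v] continuous_on_subset by blast
  have "continuous_on (realization_points K) (\<lambda>x w. \<Sum>v | v \<in> \<Union>K \<and> f v = w. x v)"
    by (intro continuous_on_coordinatewise_then_product continuous_on_sum c)
  then have "continuous_on (realization_points K) (realization_map K f)"
    by (rule continuous_on_eq) (auto simp: eq)
  then show ?thesis
    using realization_map_in[OF _ assms(2)] by (auto simp: realization_def)
qed

lemma Union_Delta_ws_hat: "\<Union>(Delta_ws_hat n) \<subseteq> Pow {1..n}"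
  by (auto simp: Delta_ws_hat_def clique_complex_def)

context
  notes One_nat_def [simp del]
begin

lemma sym_group_weakly_separated:
  assumes "g \<in> carrier (sym_group n)" "A \<subseteq> {1..n}" "B \<subseteq> {1..n}"
  shows "weakly_separated (g A) (g B) \<longleftrightarrow> weakly_separated A B"
proof -
  have imp: "weakly_separated (g A) (g B)"
    if "weakly_separated A B" "A \<subseteq> {1..n}" "B \<subseteq> {1..n}" for A B
  proof -
    have P: "A \<in> Pow {1..n}" "B \<in> Pow {1..n}" using that by auto
    note ws = weakly_separated_alpha weakly_separated_w0 w0_in
    show ?thesis
      using assms(1) unfolding carrier_sym_group
      by (elim insertE emptyE) (simp_all only: compose_eq[OF P(1)] compose_eq[OF P(2)]
          restrict_apply' P that ws)
  qed
  have "g A \<subseteq> {1..n}" "g B \<subseteq> {1..n}" "g (g A) = A" "g (g B) = B"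
    using assms sym_group_app by auto
  then show ?thesis using imp assms by metis
qed

lemma sym_group_simplicial:
  assumes "g \<in> carrier (sym_group n)" "F \<in> Delta_ws_hat n"
  shows "g ` F \<in> Delta_ws_hat n"
proof -
  note in' = sym_group_app[OF assms(1)]
  have "frozen n A" if "frozen n (g A)" "A \<subseteq> {1..n}" for A
    unfolding frozen_def
  proof (intro conjI allI impI)
    fix B assume B: "B \<subseteq> {1..n}"
    have "weakly_separated (g A) (g B)" using that(1) in'(1)[OF B] unfolding frozen_def by blast
    then show "weakly_separated A B" using sym_group_weakly_separated[OF assms(1) that(2) B] by blast
  qed fact
  note fr = this
  have F: "finite F" "\<And>A. A \<in> F \<Longrightarrow> A \<subseteq> {1..n} \<and> \<not> frozen n A" "pairwise weakly_separated F"
    using assms(2) unfolding Delta_ws_hat_def clique_complex_def by blast+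
  have "g ` F \<subseteq> {A. A \<subseteq> {1..n} \<and> \<not> frozen n A}"
  proof (rule image_subsetI, rule CollectI)
    fix A assume "A \<in> F"
    then have "A \<subseteq> {1..n}" "\<not> frozen n A" using F(2) by blast+
    then show "g A \<subseteq> {1..n} \<and> \<not> frozen n (g A)" using in'(1)[of A] fr[of A] by metis
  qed
  moreover have "pairwise weakly_separated (g ` F)"
  proof (unfold pairwise_image, rule pairwiseI, rule impI)
    fix A B assume AB: "A \<in> F" "B \<in> F" "A \<noteq> B"
    then have "weakly_separated A B" using F(3) by (simp add: pairwise_def)
    then show "weakly_separated (g A) (g B)"
      using sym_group_weakly_separated[OF assms(1)] F(2) AB by metis
  qed
  ultimately show ?thesis
    using F(1) by (simp add: Delta_ws_hat_def clique_complex_def)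
qed

lemma G_space_Delta_ws_hat:
  "G_space (sym_group n) (realization (Delta_ws_hat n)) (sym_action n)"
proof -
  let ?G = "sym_group n" and ?K = "Delta_ws_hat n" and ?S = "Pow {1..n}"
  let ?P = "realization_points ?K"
  note comp = realization_map_compose[OF _ sym_group_simplicial Union_Delta_ws_hat]
  have inP: "sym_action n g x \<in> ?P" if "g \<in> carrier ?G" "x \<in> ?P" for g x
    using that realization_map_in sym_group_simplicial unfolding sym_action_def by blast
  have inv: "sym_action n g (sym_action n g x) = x" if "g \<in> carrier ?G" "x \<in> ?P" for g x
    using comp[of x n g g] that sym_group_involution[OF that(1)]
      realization_map_id[OF Union_Delta_ws_hat, of n]
    by (simp add: sym_action_def)
  have bij: "sym_action n g \<in> Bij ?P" if "g \<in> carrier ?G" for g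
  proof -
    have "bij_betw (sym_action n g) ?P ?P"
      by (rule bij_betw_byWitness[where f' = "sym_action n g"]) (use inP inv that in auto)
    then show ?thesis by (simp add: Bij_def sym_action_def realization_map_def)
  qed
  have "sym_action n \<in> hom ?G (BijGroup ?P)"
  proof (rule homI)
    fix f g assume fg: "f \<in> carrier ?G" "g \<in> carrier ?G"
    have "sym_action n (compose ?S f g) = compose ?P (sym_action n f) (sym_action n g)"
    proof
      fix x
      show "sym_action n (compose ?S f g) x = compose ?P (sym_action n f) (sym_action n g) x"
        using comp[of x n g f] fg
        by (cases "x \<in> ?P") (simp_all add: sym_action_def compose_def, simp add: realization_map_def)
    qed
    then show "sym_action n (f \<otimes>\<^bsub>?G\<^esub> g) = sym_action n f \<otimes>\<^bsub>BijGroup ?P\<^esub> sym_action n g"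
      using fg bij by (simp add: mult_sym_group BijGroup_def)
  qed (simp add: BijGroup_def bij)
  then have "group_action ?G ?P (sym_action n)"
    by (intro group_action.intro group_hom.intro group_hom_axioms.intro group_sym_group group_BijGroup)
  moreover have "continuous_map (realization ?K) (realization ?K) (sym_action n g)"
    if "g \<in> carrier ?G" for g
    unfolding sym_action_def
    by (intro continuous_realization_map finite_subset[OF Union_Delta_ws_hat]
        sym_group_simplicial that) auto
  ultimately show ?thesis by (simp add: G_space_def realization_def)
qed

end

end

theory Submission
  imports Defs
begin

text \<open>Let \<open>R\<close> consist of the sets \<open>{i}\<close> and \<open>[n] - {i}\<close> with \<open>1 < i < n\<close>. For every face \<open>W\<close> of the complex
  with vertices in \<open>R\<close>, there is a vertex outside \<open>R\<close> that is adjacent to \<open>W\<close> and to every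
  vertex outside \<open>R\<close> that is adjacent to \<open>W\<close>: if \<open>{2}\<close> is not in \<open>W\<close>, then \<open>{1, i}\<close> will do, where
  \<open>{i}\<close> is the least singleton in \<open>W\<close>, and \<open>i = n\<close> if there is none; otherwise \<open>[n] - {2}\<close> is not
  in \<open>W\<close>, and one passes to complements. Call such vertices the apexes of \<open>W\<close>. Apexes of nested faces
  are adjacent, and they are defined invariantly under symmetries, so three equivariant straight-line
  homotopies contract the complex: delete the small coordinates in \<open>R\<close>, move to a mixture of the
  apexes of the large coordinates in \<open>R\<close>, and move to the barycentre of the apexes of the empty face.\<close>

section \<open>Equivariant contractions of flag complexes\<close>

text \<open>These are the cone points of the flag complex on the vertices outside \<open>R\<close>
  adjacent to all of \<open>W\<close>. Keeping all of them, instead of choosing one, preserves the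
  symmetry.\<close>

definition apexes :: "'v set \<Rightarrow> ('v \<Rightarrow> 'v \<Rightarrow> bool) \<Rightarrow> 'v set \<Rightarrow> 'v set \<Rightarrow> 'v set" where
  "apexes V E R W =
     {a \<in> V - R. (\<forall>w\<in>W. E a w) \<and> (\<forall>u\<in>V - R. (\<forall>w\<in>W. E u w) \<longrightarrow> E a u)}"

definition normalize_on :: "'v set \<Rightarrow> ('v \<Rightarrow> real) \<Rightarrow> 'v \<Rightarrow> real" where
  "normalize_on V y = (\<lambda>v. y v / sum y V)"

locale flag_complex_action =
  fixes V :: "'v set" and E :: "'v \<Rightarrow> 'v \<Rightarrow> bool" and R :: "'v set"
    and G :: "('v \<Rightarrow> 'v, 'm) monoid_scheme"
  assumes finite_V: "finite V"
    and E_refl: "\<And>v. E v v"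
    and E_sym: "\<And>u v. E u v \<Longrightarrow> E v u"
    and bij_V: "\<And>g. g \<in> carrier G \<Longrightarrow> bij_betw g V V"
    and E_invariant: "\<And>g u v. g \<in> carrier G \<Longrightarrow> u \<in> V \<Longrightarrow> v \<in> V \<Longrightarrow> E (g u) (g v) \<longleftrightarrow> E u v"
    and R_V: "R \<subseteq> V"
    and R_invariant: "\<And>g. g \<in> carrier G \<Longrightarrow> g ` R = R"
begin

lemma inj_on_V: "g \<in> carrier G \<Longrightarrow> inj_on g V"
  using bij_V by (auto simp: bij_betw_def)

lemma mem_R_iff:
  assumes "g \<in> carrier G" "v \<in> V"
  shows "g v \<in> R \<longleftrightarrow> v \<in> R"
  using R_invariant[OF assms(1)] inj_on_V[OF assms(1)] R_V assms(2)
  by (metis inj_on_image_mem_iff)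

text \<open>Since \<open>g\<close> permutes \<open>V\<close> and preserves \<open>R\<close> and
  \<open>E\<close>, the quantifier over \<open>u\<close> can be reindexed along
  \<open>g\<close>.\<close>

lemma apexes_invariant:
  assumes g: "g \<in> carrier G" and v: "v \<in> V" and W: "W \<subseteq> V"
  shows "g v \<in> apexes V E R (g ` W) \<longleftrightarrow> v \<in> apexes V E R W"
proof -
  have gV: "g ` V = V" using bij_V[OF g] by (simp add: bij_betw_def)
  have E: "E (g a) (g b) \<longleftrightarrow> E a b" if "a \<in> V" "b \<in> V" for a b
    using E_invariant[OF g] that by blast
  have "(\<forall>u\<in>V - R. (\<forall>w\<in>g ` W. E u w) \<longrightarrow> E (g v) u) \<longleftrightarrow>
      (\<forall>u\<in>g ` V. u \<notin> R \<longrightarrow> (\<forall>w\<in>g ` W. E u w) \<longrightarrow> E (g v) u)"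
    unfolding gV by blast
  also have "\<dots> \<longleftrightarrow> (\<forall>u\<in>V. u \<notin> R \<longrightarrow> (\<forall>w\<in>W. E u w) \<longrightarrow> E v u)"
    using E v W by (simp add: mem_R_iff[OF g] subset_iff)
  finally show ?thesis
    using E[OF v] v W mem_R_iff[OF g v] gV unfolding apexes_def by (auto simp: subset_iff)
qed

section \<open>Barycentric coordinates and the action on them\<close>

abbreviation "K \<equiv> clique_complex V E"
abbreviation "pts \<equiv> realization_points K"
abbreviation "act \<equiv> realization_map K"

text \<open>Finiteness of \<open>V\<close> replaces the sum over the varying support by a sum over a
  fixed set.\<close>

lemma mem_pts_iff:
  "x \<in> pts \<longleftrightarrow> (\<forall>v. 0 \<le> x v) \<and> {v. x v \<noteq> 0} \<subseteq> V \<and> pairwise E {v. x v \<noteq> 0} \<and> sum x V = 1"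
proof -
  have "sum x {v. x v \<noteq> 0} = sum x V" if "{v. x v \<noteq> 0} \<subseteq> V"
    using that finite_V by (intro sum.mono_neutral_left) auto
  moreover have "finite {v. x v \<noteq> 0}" if "{v. x v \<noteq> 0} \<subseteq> V"
    using that finite_V by (rule finite_subset)
  ultimately show ?thesis
    unfolding realization_points_def clique_complex_def by auto
qed

lemma E_support:
  assumes "x \<in> pts" "x u \<noteq> 0" "x v \<noteq> 0"
  shows "E u v"
  using assms E_refl by (cases "u = v") (auto simp: mem_pts_iff pairwise_def)

lemma image_clique:
  assumes "g \<in> carrier G" "F \<in> K"
  shows "g ` F \<in> K"
proof -
  have "g ` V = V" using bij_V[OF assms(1)] by (simp add: bij_betw_def)
  with assms show ?thesis
    unfolding clique_complex_def pairwise_def by (auto simp: E_invariant subset_iff)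
qed

lemma act_in: "g \<in> carrier G \<Longrightarrow> x \<in> pts \<Longrightarrow> act g x \<in> pts"
  using realization_map_in image_clique by blast

text \<open>Injectivity of \<open>g\<close> on \<open>V\<close> leaves at most one term in each
  fibre, so the action merely permutes coordinates.\<close>

lemma act_apply:
  assumes "g \<in> carrier G" "x \<in> pts" "v \<in> V"
  shows "act g x (g v) = x v"
proof -
  have "inj_on g V" using bij_V[OF assms(1)] by (simp add: bij_betw_def)
  then have "{u. x u \<noteq> 0 \<and> g u = g v} = (if x v \<noteq> 0 then {v} else {})"
    using assms by (auto simp: mem_pts_iff inj_on_def)
  then show ?thesis using assms by (auto simp: realization_map_def)
qed

text \<open>Continuity and equivariance are required coordinatewise, the form in which explicit
  formulas provide them.\<close>

definition self_map :: "(('v \<Rightarrow> real) \<Rightarrow> 'v \<Rightarrow> real) \<Rightarrow> bool" where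
  "self_map q \<longleftrightarrow> (\<forall>x\<in>pts. q x \<in> pts) \<and> (\<forall>v. continuous_on pts (\<lambda>x. q x v)) \<and>
     (\<forall>g\<in>carrier G. \<forall>x\<in>pts. \<forall>v\<in>V. q (act g x) (g v) = q x v)"

lemma self_map_equivariant:
  assumes "self_map q"
  shows "equivariant G (realization K) act act q"
  unfolding equivariant_def
proof (intro ballI ext)
  fix g x w assume g: "g \<in> carrier G" and "x \<in> topspace (realization K)"
  then have x: "x \<in> pts" by (simp add: realization_def)
  have q: "q x \<in> pts" "q (act g x) \<in> pts"
    using assms x act_in[OF g] by (auto simp: self_map_def)
  show "q (act g x) w = act g (q x) w"
  proof (cases "w \<in> V")
    case True
    then obtain v where "v \<in> V" "w = g v"
      using bij_V[OF g] by (auto simp: bij_betw_def)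
    then show ?thesis
      using act_apply[OF g q(1)] assms g x by (simp add: self_map_def)
  next
    case False
    then have "r w = 0" if "r \<in> pts" for r using that by (auto simp: mem_pts_iff)
    then show ?thesis using q act_in[OF g q(1)] by metis
  qed
qed

section \<open>Equivariant straight-line homotopies\<close>

lemma continuous_on_coordinate: "continuous_on S (\<lambda>x :: 'v \<Rightarrow> real. x v)"
  using continuous_on_product_coordinates[of v] continuous_on_subset by blast

lemma self_map_id: "self_map id"
  by (auto simp: self_map_def act_apply continuous_on_coordinate)

text \<open>By \<open>pq\<close> the supports of \<open>p x\<close> and \<open>q x\<close> together
  form a clique. In a flag complex this is a face, and it contains the whole segment.\<close>

lemma self_map_segment:
  assumes p: "self_map p" and q: "self_map q" and t: "0 \<le> t" "t \<le> 1"
    and pq: "\<And>x u v. x \<in> pts \<Longrightarrow> p x u \<noteq> 0 \<Longrightarrow> q x v \<noteq> 0 \<Longrightarrow> E u v"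
  shows "self_map (\<lambda>x v. (1 - t) * p x v + t * q x v)"
  unfolding self_map_def
proof (intro conjI ballI allI)
  fix x assume x: "x \<in> pts"
  then have pts: "p x \<in> pts" "q x \<in> pts" using p q by (auto simp: self_map_def)
  have supp: "p x v \<noteq> 0 \<or> q x v \<noteq> 0" if "(1 - t) * p x v + t * q x v \<noteq> 0" for v
    using that by auto
  have "sum (\<lambda>v. (1 - t) * p x v + t * q x v) V = 1"
    using pts by (simp add: sum.distrib mem_pts_iff flip: sum_distrib_left)
  moreover have "pairwise E {v. (1 - t) * p x v + t * q x v \<noteq> 0}"
  proof (rule pairwiseI)
    fix u v assume "u \<in> {v. (1 - t) * p x v + t * q x v \<noteq> 0}"
      "v \<in> {v. (1 - t) * p x v + t * q x v \<noteq> 0}"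
    then have "p x u \<noteq> 0 \<or> q x u \<noteq> 0" "p x v \<noteq> 0 \<or> q x v \<noteq> 0" using supp by auto
    then show "E u v" using pq[OF x] E_sym E_support pts by blast
  qed
  moreover have "{v. (1 - t) * p x v + t * q x v \<noteq> 0} \<subseteq> V"
    using pts supp unfolding mem_pts_iff by blast
  ultimately show "(\<lambda>v. (1 - t) * p x v + t * q x v) \<in> pts"
    using pts t by (simp add: mem_pts_iff)
next
  fix v show "continuous_on pts (\<lambda>x. (1 - t) * p x v + t * q x v)"
    using p q by (intro continuous_intros) (auto simp: self_map_def)
qed (use p q in \<open>auto simp: self_map_def\<close>)

lemma homotopic_segment:
  assumes p: "self_map p" and q: "self_map q"
    and pq: "\<And>x u v. x \<in> pts \<Longrightarrow> p x u \<noteq> 0 \<Longrightarrow> q x v \<noteq> 0 \<Longrightarrow> E u v"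
  shows "G_homotopic G (realization K) act (realization K) act p q"
proof -
  define h where "h = (\<lambda>(t :: real, x) v. (1 - t) * p x v + t * q x v)"
  have seg: "self_map (\<lambda>x. h (t, x))" if "t \<in> {0..1}" for t
    using that pq unfolding h_def case_prod_conv by (intro self_map_segment[OF p q]) auto
  have "continuous_on ({0..1} \<times> pts) (\<lambda>z. h z v)" for v
  proof -
    have "continuous_on ({0..1 :: real} \<times> pts) (\<lambda>z. f (snd z) v)" if "self_map f" for f
    proof (rule continuous_on_compose2[of pts "\<lambda>x. f x v" _ snd])
      show "continuous_on pts (\<lambda>x. f x v)" using that by (simp add: self_map_def)
      show "continuous_on ({0..1} \<times> pts) snd"
        by (intro continuous_on_snd continuous_on_id)
    qed auto
    then show ?thesis
      unfolding h_def case_prod_unfold using p q by (intro continuous_intros) auto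
  qed
  then have "continuous_on ({0..1} \<times> pts) h"
    by (rule continuous_on_coordinatewise_then_product)
  moreover have "h z \<in> pts" if "z \<in> {0..1} \<times> pts" for z
    using that seg[of "fst z"] by (auto simp: self_map_def)
  ultimately have "continuous_map (prod_topology (top_of_set {0..1}) (realization K)) (realization K) h"
    by (auto simp: realization_def prod_topology_subtopology_eu simp flip: subtopology_Times)
  moreover have "equivariant G (realization K) act act (\<lambda>x. h (t, x))" if "t \<in> {0..1}" for t
    using that by (intro self_map_equivariant seg)
  ultimately show ?thesis
    unfolding G_homotopic_def homotopic_with_def
    by (intro exI[of _ h]) (simp add: h_def)
qed

text \<open>The total over \<open>V\<close> is positive, so the division is continuous, and it is
  invariant because \<open>g\<close> permutes \<open>V\<close>.\<close>

lemma self_map_normalize: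
  assumes nonneg: "\<And>x v. x \<in> pts \<Longrightarrow> 0 \<le> y x v"
    and inV: "\<And>x v. x \<in> pts \<Longrightarrow> y x v \<noteq> 0 \<Longrightarrow> v \<in> V"
    and clique: "\<And>x u v. x \<in> pts \<Longrightarrow> y x u \<noteq> 0 \<Longrightarrow> y x v \<noteq> 0 \<Longrightarrow> E u v"
    and nonzero: "\<And>x. x \<in> pts \<Longrightarrow> \<exists>v. y x v \<noteq> 0"
    and cont: "\<And>v. continuous_on pts (\<lambda>x. y x v)"
    and equiv: "\<And>g x v. g \<in> carrier G \<Longrightarrow> x \<in> pts \<Longrightarrow> v \<in> V \<Longrightarrow> y (act g x) (g v) = y x v"
  shows "self_map (\<lambda>x. normalize_on V (y x))"
proof -
  have pos: "sum (y x) V > 0" if "x \<in> pts" for x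
  proof -
    obtain v where "y x v \<noteq> 0" using nonzero \<open>x \<in> pts\<close> by blast
    then show ?thesis
      using nonneg inV \<open>x \<in> pts\<close> finite_V by (intro sum_pos2[of V v]) (auto simp: less_le)
  qed
  show ?thesis
    unfolding self_map_def normalize_on_def
  proof (intro conjI ballI allI)
    fix x assume x: "x \<in> pts"
    then have "(\<Sum>v\<in>V. y x v / sum (y x) V) = 1"
      using pos[OF x] by (simp flip: sum_divide_distrib)
    then show "(\<lambda>v. y x v / sum (y x) V) \<in> pts"
      using pos[OF x] nonneg[OF x] inV[OF x] clique[OF x]
      by (auto simp: mem_pts_iff intro!: pairwiseI divide_nonneg_pos)
  next
    fix v show "continuous_on pts (\<lambda>x. y x v / sum (y x) V)"
      using pos cont by (intro continuous_intros) force+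
  next
    fix g x v assume gxv: "g \<in> carrier G" "x \<in> pts" "v \<in> V"
    have "sum (y (act g x)) V = sum (y x) V"
      using bij_V[OF gxv(1)] by (rule sum.reindex_bij_betw[symmetric, THEN trans])
        (use equiv gxv in simp)
    then show "y (act g x) (g v) / sum (y (act g x)) V = y x v / sum (y x) V"
      using equiv gxv by simp
  qed
qed

end

text \<open>Near a point \<open>x\<close> with \<open>R\<close>-vertices \<open>W\<close> in its support one would like to push towards
  \<open>apexes V E R W\<close>, but this set jumps when a coordinate in \<open>R\<close> vanishes. So one uses
  the super-level sets \<open>W\<close> of \<open>x\<close> on \<open>R\<close> at levels below a threshold, with weights that depend
  continuously on \<open>x\<close>, and first lowers the coordinates in \<open>R\<close> by that threshold, cutting off at 0.\<close>

locale flag_complex_apexes = flag_complex_action V E R G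
  for V :: "'v set" and E and R and G :: "('v \<Rightarrow> 'v, 'm) monoid_scheme" +
  assumes apexes_nonempty: "\<And>W. W \<subseteq> R \<Longrightarrow> pairwise E W \<Longrightarrow> apexes V E R W \<noteq> {}"
begin

section \<open>Cutoff and weights of super-level sets\<close>

lemma finite_R: "finite R"
  using R_V finite_V by (rule finite_subset)

text \<open>Chosen so that \<open>card V * threshold < 1\<close>: not all coordinates of a point can
  be at most \<open>threshold\<close>.\<close>

definition threshold :: real where
  "threshold = 1 / (card V + 1)"

definition cutoff :: "('v \<Rightarrow> real) \<Rightarrow> 'v \<Rightarrow> real" where
  "cutoff x v = (if v \<in> R then max 0 (x v - threshold) else x v)"

text \<open>For \<open>W \<subseteq> R\<close> and \<open>x\<close> in \<open>pts\<close>, this is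
  nonzero exactly when \<open>x\<close> is positive on \<open>W\<close>, below
  \<open>threshold\<close> on \<open>R - W\<close>, and larger at each vertex of \<open>W\<close>
  than at each vertex of \<open>R - W\<close>.\<close>

definition level_weight :: "'v set \<Rightarrow> ('v \<Rightarrow> real) \<Rightarrow> real" where
  "level_weight W x =
     (\<Prod>v\<in>W. x v) * (\<Prod>w\<in>R - W. max 0 (threshold - x w)) *
     (\<Prod>v\<in>W. \<Prod>w\<in>R - W. max 0 (x v - x w))"

definition apex_sum :: "('v \<Rightarrow> real) \<Rightarrow> 'v \<Rightarrow> real" where
  "apex_sum x v = (\<Sum>W\<in>Pow R. level_weight W x * of_bool (v \<in> apexes V E R W))"

text \<open>The vertex \<open>b\<close> lies outside \<open>R\<close> and is adjacent to all of
  \<open>W\<close>, since \<open>W \<subseteq> W'\<close>; an apex of \<open>W\<close> is adjacent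
  to every such vertex.\<close>

lemma E_apexes:
  assumes "W \<subseteq> W'" "a \<in> apexes V E R W" "b \<in> apexes V E R W'"
  shows "E a b"
  using assms unfolding apexes_def by blast

lemma level_weight_nonneg: "x \<in> pts \<Longrightarrow> 0 \<le> level_weight W x"
  unfolding level_weight_def by (intro mult_nonneg_nonneg prod_nonneg) (auto simp: mem_pts_iff)

lemma level_weight_nonzeroD:
  assumes "level_weight W x \<noteq> 0" "W \<subseteq> R"
  shows "v \<in> W \<Longrightarrow> x v \<noteq> 0"
    and "w \<in> R - W \<Longrightarrow> x w < threshold"
    and "v \<in> W \<Longrightarrow> w \<in> R - W \<Longrightarrow> x w < x v"
proof -
  have fin: "finite W" "finite (R - W)" using assms(2) finite_R finite_subset by auto
  have ne: "\<forall>v\<in>W. x v \<noteq> 0" "\<forall>w\<in>R - W. max 0 (threshold - x w) \<noteq> 0"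
    "\<forall>v\<in>W. \<forall>w\<in>R - W. max 0 (x v - x w) \<noteq> 0"
    using assms(1) fin unfolding level_weight_def by (simp_all add: prod_zero_iff)
  have max: "b < a" if "max 0 (a - b) \<noteq> 0" for a b :: real
    using that by (simp add: max_def split: if_splits)
  show "v \<in> W \<Longrightarrow> x v \<noteq> 0" "w \<in> R - W \<Longrightarrow> x w < threshold"
    "v \<in> W \<Longrightarrow> w \<in> R - W \<Longrightarrow> x w < x v"
    using ne max by blast+
qed

text \<open>If \<open>v\<close> were only in \<open>W\<close> and \<open>w\<close> only in
  \<open>W'\<close>, both \<open>x w < x v\<close> and \<open>x v < x w\<close> would hold.\<close>

lemma level_sets_nested:
  assumes "level_weight W x \<noteq> 0" "W \<subseteq> R" "level_weight W' x \<noteq> 0" "W' \<subseteq> R"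
  shows "W \<subseteq> W' \<or> W' \<subseteq> W"
proof (rule ccontr)
  assume "\<not> ?thesis"
  then obtain v w where "v \<in> W" "v \<notin> W'" "w \<in> W'" "w \<notin> W" by blast
  then show False
    using level_weight_nonzeroD(3)[OF assms(1,2), of v w]
      level_weight_nonzeroD(3)[OF assms(3,4), of w v] assms(2,4) by fastforce
qed

lemma level_weight_act:
  assumes g: "g \<in> carrier G" and x: "x \<in> pts" and W: "W \<subseteq> R"
  shows "level_weight (g ` W) (act g x) = level_weight W x"
proof -
  have inj: "inj_on g A" if "A \<subseteq> R" for A
    using inj_on_V[OF g] that R_V by (meson inj_on_subset subset_trans)
  have diff: "R - g ` W = g ` (R - W)"
    using inj_on_image_set_diff[OF inj[OF order_refl], of R W] W R_invariant[OF g] by auto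
  have app: "act g x (g v) = x v" if "v \<in> R" for v
    using act_apply[OF g x] that R_V by blast
  have reindex: "(\<Prod>v\<in>g ` A. f v) = (\<Prod>v\<in>A. f (g v))" if "A \<subseteq> R" for A and f :: "'v \<Rightarrow> real"
    using prod.reindex[OF inj[OF that]] by simp
  have "W \<subseteq> R" "R - W \<subseteq> R" using W by auto
  then show ?thesis
    unfolding level_weight_def diff using app
    by (simp add: reindex subset_iff)
qed

lemma apex_sum_act:
  assumes g: "g \<in> carrier G" and x: "x \<in> pts" and v: "v \<in> V"
  shows "apex_sum (act g x) (g v) = apex_sum x v"
proof -
  have "bij_betw g R R"
    using inj_on_V[OF g] R_V R_invariant[OF g] by (auto simp: bij_betw_def intro: inj_on_subset)
  \<comment> \<open>The sum over subsets of \<open>R\<close> is reindexed by taking images under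
    \<open>g\<close>.\<close>
  then have "apex_sum (act g x) (g v) =
      (\<Sum>W\<in>Pow R. level_weight (g ` W) (act g x) * of_bool (g v \<in> apexes V E R (g ` W)))"
    unfolding apex_sum_def by (rule sum.reindex_bij_betw[OF bij_betw_Pow, symmetric])
  also have "\<dots> = apex_sum x v"
    unfolding apex_sum_def
  proof (rule sum.cong)
    fix W assume "W \<in> Pow R"
    then have "W \<subseteq> R" "W \<subseteq> V" using R_V by auto
    then show "level_weight (g ` W) (act g x) * of_bool (g v \<in> apexes V E R (g ` W)) =
        level_weight W x * of_bool (v \<in> apexes V E R W)"
      by (simp add: level_weight_act[OF g x] apexes_invariant[OF g v])
  qed simp
  finally show ?thesis .
qed

lemma apex_sum_nonzeroE:
  assumes "apex_sum x a \<noteq> 0"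
  obtains W where "W \<subseteq> R" "level_weight W x \<noteq> 0" "a \<in> apexes V E R W"
  using assms unfolding apex_sum_def
  by (auto elim!: sum.not_neutral_contains_not_neutral split: if_splits)

lemma apex_sum_nonzero:
  assumes x: "x \<in> pts"
  shows "\<exists>a. apex_sum x a \<noteq> 0"
proof -
  \<comment> \<open>This super-level set always has positive weight: off it, the coordinates in
    \<open>R\<close> are 0 and hence below \<open>threshold\<close>.\<close>
  define W where "W = {v \<in> R. x v \<noteq> 0}"
  have W: "W \<subseteq> R" by (auto simp: W_def)
  have "pairwise E W"
    using E_support[OF x] by (auto simp: W_def intro: pairwiseI)
  then obtain a where a: "a \<in> apexes V E R W" using apexes_nonempty[OF W] by blast
  have pos: "0 < x v" if "v \<in> W" for v
    using that x by (auto simp: W_def mem_pts_iff less_le)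
  have "0 < threshold" by (simp add: threshold_def)
  then have "0 < level_weight W x"
    unfolding level_weight_def using pos
    by (intro mult_pos_pos prod_pos) (auto simp: W_def)
  then have "0 < apex_sum x a"
    unfolding apex_sum_def using W a finite_R level_weight_nonneg[OF x]
    by (intro sum_pos2[of _ W]) auto
  then show ?thesis by (intro exI[of _ a]) simp
qed

lemma cutoff_nonzeroD:
  assumes "cutoff x v \<noteq> 0" "x \<in> pts"
  shows "x v \<noteq> 0" and "v \<in> R \<Longrightarrow> threshold < x v"
proof -
  have "0 < threshold" by (simp add: threshold_def)
  then show "x v \<noteq> 0" "v \<in> R \<Longrightarrow> threshold < x v"
    using assms(1) by (auto simp: cutoff_def max_def split: if_splits)
qed

lemma cutoff_nonzero:
  assumes x: "x \<in> pts"
  shows "\<exists>v. cutoff x v \<noteq> 0"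
proof (rule ccontr)
  assume "\<not> ?thesis"
  \<comment> \<open>Outside \<open>R\<close> a vanishing cutoff means
    \<open>x v = 0\<close>.\<close>
  then have "x v \<le> threshold" for v
    by (cases "v \<in> R") (auto simp: cutoff_def max_def threshold_def split: if_splits dest: spec[of _ v])
  then have "sum x V \<le> card V * threshold" using sum_bounded_above by metis
  also have "\<dots> < 1" by (simp add: threshold_def)
  finally show False using x by (simp add: mem_pts_iff)
qed

lemma self_map_cutoff: "self_map (\<lambda>x. normalize_on V (cutoff x))"
proof (rule self_map_normalize)
  fix g x v assume "g \<in> carrier G" "x \<in> pts" "v \<in> V"
  then show "cutoff (act g x) (g v) = cutoff x v"
    by (simp add: cutoff_def mem_R_iff act_apply)
next
  fix v show "continuous_on pts (\<lambda>x. cutoff x v)"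
    unfolding cutoff_def
    by (cases "v \<in> R") (auto intro!: continuous_intros continuous_on_coordinate)
next
  fix x v assume "x \<in> pts" "cutoff x v \<noteq> 0"
  then show "v \<in> V" using cutoff_nonzeroD(1) by (auto simp: mem_pts_iff)
next
  fix x u v assume "x \<in> pts" "cutoff x u \<noteq> 0" "cutoff x v \<noteq> 0"
  then show "E u v" using E_support cutoff_nonzeroD(1) by blast
qed (auto simp: cutoff_nonzero, simp add: cutoff_def mem_pts_iff)

lemma self_map_apex_sum: "self_map (\<lambda>x. normalize_on V (apex_sum x))"
proof (rule self_map_normalize)
  fix x v assume "x \<in> pts" "apex_sum x v \<noteq> 0"
  then show "v \<in> V" by (auto simp: apexes_def elim!: apex_sum_nonzeroE)
next
  fix x a b assume "x \<in> pts" "apex_sum x a \<noteq> 0" "apex_sum x b \<noteq> 0"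
  then show "E a b"
    by (metis apex_sum_nonzeroE level_sets_nested E_apexes E_sym)
next
  fix v show "continuous_on pts (\<lambda>x. apex_sum x v)"
    unfolding apex_sum_def level_weight_def
    by (intro continuous_intros continuous_on_coordinate)
qed (auto simp: apex_sum_nonzero apex_sum_act,
    simp add: apex_sum_def sum_nonneg level_weight_nonneg)

lemma self_map_barycentre: "self_map (\<lambda>x. normalize_on V (\<lambda>v. of_bool (v \<in> apexes V E R {})))"
proof (rule self_map_normalize)
  fix g x v assume "g \<in> carrier G" "v \<in> V"
  then show "(of_bool (g v \<in> apexes V E R {}) :: real) = of_bool (v \<in> apexes V E R {})"
    using apexes_invariant[of g v "{}"] by simp
qed (use apexes_nonempty[of "{}"] in \<open>auto simp: apexes_def split: if_splits\<close>)

section \<open>The three homotopies and the contraction\<close>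

lemma normalize_on_nonzeroD: "normalize_on V y v \<noteq> 0 \<Longrightarrow> y v \<noteq> 0"
  by (auto simp: normalize_on_def)

lemma homotopic_barycentre:
  "G_homotopic G (realization K) act (realization K) act
     id (\<lambda>x. normalize_on V (\<lambda>v. of_bool (v \<in> apexes V E R {})))"
proof -
  have "G_homotopic G (realization K) act (realization K) act
      id (\<lambda>x. normalize_on V (cutoff x))"
    using self_map_id self_map_cutoff
  proof (rule homotopic_segment)
    fix x u v assume "x \<in> pts" "id x u \<noteq> 0" "normalize_on V (cutoff x) v \<noteq> 0"
    then show "E u v" using E_support cutoff_nonzeroD(1) normalize_on_nonzeroD by (metis id_apply)
  qed
  moreover have "G_homotopic G (realization K) act (realization K) act
      (\<lambda>x. normalize_on V (cutoff x)) (\<lambda>x. normalize_on V (apex_sum x))"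
    using self_map_cutoff self_map_apex_sum
  proof (rule homotopic_segment)
    fix x u a assume x: "x \<in> pts"
      and "normalize_on V (cutoff x) u \<noteq> 0" "normalize_on V (apex_sum x) a \<noteq> 0"
    then have u: "cutoff x u \<noteq> 0" and "apex_sum x a \<noteq> 0"
      by (auto dest: normalize_on_nonzeroD)
    then obtain W where W: "W \<subseteq> R" "level_weight W x \<noteq> 0" "a \<in> apexes V E R W"
      by (elim apex_sum_nonzeroE)
    have xu: "x u \<noteq> 0" using cutoff_nonzeroD(1)[OF u x] .
    \<comment> \<open>A vertex of \<open>R\<close> surviving the cutoff exceeds
      \<open>threshold\<close>, so it lies in \<open>W\<close>. A support vertex outside
      \<open>R\<close> is adjacent to all of \<open>W\<close>, hence to the apex
      \<open>a\<close>.\<close>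
    have "E a u"
    proof (cases "u \<in> R")
      case True
      then have "u \<in> W"
        using cutoff_nonzeroD(2)[OF u x] level_weight_nonzeroD(2)[OF W(2,1), of u] by fastforce
      then show ?thesis using W(3) by (auto simp: apexes_def)
    next
      case False
      moreover have "u \<in> V" using xu x by (auto simp: mem_pts_iff)
      moreover have "E u w" if "w \<in> W" for w
        using E_support[OF x xu] level_weight_nonzeroD(1)[OF W(2,1) that] .
      ultimately show ?thesis using W(3) by (auto simp: apexes_def)
    qed
    then show "E u a" by (rule E_sym)
  qed
  moreover have "G_homotopic G (realization K) act (realization K) act
      (\<lambda>x. normalize_on V (apex_sum x)) (\<lambda>x. normalize_on V (\<lambda>v. of_bool (v \<in> apexes V E R {})))"
    using self_map_apex_sum self_map_barycentre
  proof (rule homotopic_segment)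
    fix x u v assume "normalize_on V (apex_sum x) u \<noteq> 0"
      "normalize_on V (\<lambda>v. of_bool (v \<in> apexes V E R {})) v \<noteq> 0"
    then have "apex_sum x u \<noteq> 0" "v \<in> apexes V E R {}"
      by (auto dest!: normalize_on_nonzeroD split: if_splits)
    then show "E u v"
      by (metis apex_sum_nonzeroE E_apexes E_sym empty_subsetI)
  qed
  ultimately show ?thesis unfolding G_homotopic_def by (meson homotopic_with_trans)
qed

theorem G_contractible_flag_complex:
  assumes "G_space G (realization K) act"
  shows "G_contractible G (realization K) act"
proof -
  define m where "m = normalize_on V (\<lambda>v. of_bool (v \<in> apexes V E R {}))"
  have m: "self_map (\<lambda>x. m)" unfolding m_def by (rule self_map_barycentre)
  \<comment> \<open>A vertex shows that \<open>pts\<close> is nonempty, so that the value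
    \<open>m\<close> of the constant self-map lies in \<open>pts\<close>; equivariance at this point
    makes \<open>m\<close> fixed.\<close>
  obtain a where "a \<in> V" using apexes_nonempty[of "{}"] by (auto simp: apexes_def)
  then have a: "(\<lambda>v. of_bool (v = a)) \<in> pts"
    using finite_V by (auto simp: mem_pts_iff pairwise_def)
  then have "m \<in> pts" using m by (auto simp: self_map_def)
  moreover have "act g m = m" if "g \<in> carrier G" for g
    using self_map_equivariant[OF m] a that unfolding equivariant_def by (auto simp: realization_def)
  ultimately have map: "G_map G (discrete_topology {()}) (\<lambda>g x. x) (realization K) act (\<lambda>_. m)"
    by (simp add: G_map_def equivariant_def realization_def)
  have "G_homotopic G (realization K) act (realization K) act (\<lambda>x. m) id"
    using homotopic_barycentre unfolding G_homotopic_def m_def by (rule homotopic_with_symD)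
  then have "G_homotopic G (realization K) act (realization K) act ((\<lambda>_. m) \<circ> (\<lambda>_. ())) id"
    by (simp add: comp_def)
  moreover have "G_map G (realization K) act (discrete_topology {()}) (\<lambda>g x. x) (\<lambda>_. ())"
    by (simp add: G_map_def equivariant_def)
  moreover have "G_homotopic G (discrete_topology {()}) (\<lambda>g x. x) (discrete_topology {()}) (\<lambda>g x. x)
      ((\<lambda>_. ()) \<circ> (\<lambda>_. m)) id"
    unfolding G_homotopic_def by (rule homotopic_with_equal) (auto simp: equivariant_def)
  ultimately show ?thesis
    using assms map unfolding G_contractible_def G_homotopy_equivalent_def by blast
qed

end

section \<open>Apexes in the weak separation complex\<close>

definition nonfrozen_sets :: "nat \<Rightarrow> nat set set" where
  "nonfrozen_sets n = {A. A \<subseteq> {1..n} \<and> \<not> frozen n A}"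

definition extreme_sets :: "nat \<Rightarrow> nat set set" where
  "extreme_sets n = (\<Union>i\<in>{2..n - 1}. {{i}, {1..n} - {i}})"

section \<open>Weak separation from singletons and pairs\<close>

context
  notes One_nat_def [simp del]
begin

text \<open>With one of the two parts empty, each difference surrounds the other, so whichever
  cardinality inequality holds suffices.\<close>

lemma weakly_separated_precedes:
  assumes "precedes (A - B) (B - A) \<or> precedes (B - A) (A - B)"
  shows "weakly_separated A B"
proof -
  have "surrounds X Y" if "precedes X Y \<or> precedes Y X" for X Y
    using that unfolding surrounds_def precedes_def
    by (metis Int_empty_left Int_empty_right Un_empty_left Un_empty_right empty_iff)
  then show ?thesis using assms unfolding weakly_separated_def by (meson nle_le)
qed

lemma weakly_separated_subset: "A \<subseteq> B \<Longrightarrow> weakly_separated A B"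
  by (rule weakly_separated_precedes) (auto simp: precedes_def)

text \<open>The gap \<open>a\<close> below \<open>b\<close> excludes initial segments, the gap
  \<open>d\<close> above \<open>c\<close> final ones.\<close>

lemma not_frozenI:
  assumes "a \<in> {1..n}" "a \<notin> A" "b \<in> A" "a < b" "c \<in> A" "d \<in> {1..n}" "d \<notin> A" "c < d"
  shows "\<not> frozen n A"
proof
  assume "frozen n A"
  then obtain k where "A = {1..k} \<or> A = {k + 1..n}" by (auto simp: frozen_iff)
  then show False using assms by auto
qed

text \<open>By cardinality the singleton must do the surrounding, and it has only one element to
  place on either side.\<close>

lemma weakly_separated_singletonD:
  assumes "weakly_separated {i} X" "i \<notin> X" "2 \<le> card X"
  shows "precedes X {i} \<or> precedes {i} X"
proof -
  have "X - {i} = X" "{i} - X = {i}" using assms(2) by auto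
  then have "surrounds {i} X" using assms by (simp add: weakly_separated_def)
  then obtain A1 A2 where "{i} = A1 \<union> A2" "precedes A1 X" "precedes X A2"
    unfolding surrounds_def by blast
  moreover from this have "A1 = {i} \<or> A2 = {i}" by blast
  ultimately show ?thesis by blast
qed

text \<open>If \<open>X\<close> avoids both elements and precedes \<open>{i}\<close>, it lies
  between 1 and \<open>i\<close>, and \<open>2 \<le> card X\<close> permits the pair to surround it.
  Otherwise one difference precedes the other.\<close>

lemma weakly_separated_pair:
  assumes X: "X \<subseteq> {1..n}" "2 \<le> card X" and i: "1 < i" and ws: "weakly_separated {i} X"
  shows "weakly_separated {1, i} X"
proof -
  consider "i \<in> X" | "i \<notin> X" "precedes {i} X" | "i \<notin> X" "1 \<in> X" "precedes X {i}"
    | "1 \<notin> X" "i \<notin> X" "precedes X {i}"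
    using weakly_separated_singletonD[OF ws _ X(2)] by blast
  then show ?thesis
  proof cases
    case 4
    then have "{1, i} - X = {1, i}" "X - {1, i} = X" by auto
    moreover have "surrounds {1, i} X"
      unfolding surrounds_def
    proof (intro exI conjI)
      show "{1, i} = {1} \<union> {i}" "{1} \<inter> {i} = {}" using i by auto
      have "1 < x" if "x \<in> X" for x using that 4 X(1) by (cases "x = 1") auto
      then show "precedes {1} X" by (simp add: precedes_def)
      show "precedes X {i}" by (rule 4)
    qed
    ultimately show ?thesis using X(2) i by (simp add: weakly_separated_def)
  qed (rule weakly_separated_precedes, use X(1) i in \<open>fastforce simp: precedes_def\<close>)+
qed

text \<open>The empty set, \<open>{1}\<close> and \<open>{n}\<close> are frozen; all other
  singletons are extreme.\<close>

lemma card_not_extreme: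
  assumes "A \<in> nonfrozen_sets n - extreme_sets n"
  shows "2 \<le> card A"
proof (rule ccontr)
  assume "\<not> 2 \<le> card A"
  have A: "A \<subseteq> {1..n}" "\<not> frozen n A" using assms by (auto simp: nonfrozen_sets_def)
  have "card A = 0 \<or> card A = 1" using \<open>\<not> 2 \<le> card A\<close> by linarith
  moreover have "finite A" using A(1) finite_subset by blast
  ultimately consider "A = {}" | j where "A = {j}" by (auto elim: card_1_singletonE)
  then show False
  proof cases
    case 1
    then have "A = {1..0}" by simp
    then show False using A(2) unfolding frozen_iff by blast
  next
    case 2
    then have "j \<notin> {2..n - 1}" using assms unfolding extreme_sets_def by blast
    moreover have "j \<in> {1..n}" using 2 A(1) by simp
    ultimately have "j = 1 \<and> 1 \<le> n \<or> j = n" by auto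
    with 2 have "A = {1..1} \<and> 1 \<le> n \<or> A = {n - 1 + 1..n} \<and> n - 1 \<le> n"
      using \<open>j \<in> {1..n}\<close> by auto
    then show False using A(2) unfolding frozen_iff by blast
  qed
qed

lemma extreme_nonfrozen: "extreme_sets n \<subseteq> nonfrozen_sets n"
proof
  fix A assume "A \<in> extreme_sets n"
  then obtain i where i: "2 \<le> i" "i < n" "A = {i} \<or> A = {1..n} - {i}"
    by (auto simp: extreme_sets_def)
  have "\<not> frozen n {i}" by (rule not_frozenI[of 1 _ _ i i n]) (use i in auto)
  moreover have "\<not> frozen n ({1..n} - {i})" by (rule not_frozenI[of i _ _ n 1 i]) (use i in auto)
  ultimately show "A \<in> nonfrozen_sets n" using i by (auto simp: nonfrozen_sets_def)
qed

lemma pair_in_apexes: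
  assumes n: "n \<ge> 4" and W: "W \<subseteq> extreme_sets n" and i: "2 < i" "i \<le> n" "i = n \<or> {i} \<in> W"
    and least: "\<And>j. {j} \<in> W \<Longrightarrow> i \<le> j" and compl: "{1..n} - {i} \<notin> W"
  shows "{1, i} \<in> apexes (nonfrozen_sets n) weakly_separated (extreme_sets n) W"
proof -
  have "\<not> frozen n {1, i}" by (rule not_frozenI[of 2 _ _ i 1 2]) (use i in auto)
  then have "{1, i} \<in> nonfrozen_sets n" using i by (auto simp: nonfrozen_sets_def)
  moreover have "{1, i} \<notin> extreme_sets n"
  proof
    assume "{1, i} \<in> extreme_sets n"
    then obtain j where j: "j \<in> {2..n - 1}" "{1, i} = {j} \<or> {1, i} = {1..n} - {j}"
      by (auto simp: extreme_sets_def)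
    \<comment> \<open>Extreme sets have 1 or \<open>n - 1\<close> elements, and \<open>n - 1\<close>
      is at least 3.\<close>
    have "card {1, i} = 2" using i by simp
    moreover have "card ({1..n} - {j}) = n - 1" using j(1) by auto
    moreover have "card {1, i} = card {j} \<or> card {1, i} = card ({1..n} - {j})" using j(2) by metis
    ultimately show False using n by simp
  qed
  moreover have "weakly_separated {1, i} w" if w: "w \<in> W" for w
  proof -
    obtain j where j: "j \<in> {2..n - 1}" "w = {j} \<or> w = {1..n} - {j}"
      using W w by (auto simp: extreme_sets_def)
    have "i \<le> j" if "w = {j}" using least[of j] w that by simp
    moreover have "{1, i} \<subseteq> w" if "w = {1..n} - {j}"
    proof -
      have "j \<noteq> i" using compl w that by blast
      then show ?thesis using that j(1) i by auto
    qed
    ultimately consider "w = {i}" | "w = {j}" "i < j" | "{1, i} \<subseteq> w"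
      using j(2) unfolding order_le_less by blast
    then show ?thesis
    proof cases
      case 1
      then show ?thesis
        using weakly_separated_subset[of "{i}" "{1, i}"] weakly_separated_commute by auto
    next
      case 2
      then show ?thesis
        using i by (intro weakly_separated_precedes) (auto simp: precedes_def)
    qed (rule weakly_separated_subset)
  qed
  moreover have "weakly_separated {1, i} u"
    if u: "u \<in> nonfrozen_sets n - extreme_sets n" and uW: "\<forall>w\<in>W. weakly_separated u w" for u
  proof (rule weakly_separated_pair)
    show u': "u \<subseteq> {1..n}" using u by (simp add: nonfrozen_sets_def)
    \<comment> \<open>This covers the default \<open>i = n\<close>, where \<open>{i}\<close> need
      not belong to \<open>W\<close>.\<close>
    have "frozen n {n}" unfolding frozen_iff using n by (intro exI[of _ "n - 1"]) auto
    then have "weakly_separated {n} u" using u' by (simp add: frozen_def)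
    then show "weakly_separated {i} u" using i(3) uW weakly_separated_commute by blast
  qed (use u card_not_extreme i in auto)
  ultimately show ?thesis by (auto simp: apexes_def)
qed

text \<open>The complement has elements on both sides of \<open>i\<close>, namely 1 and
  \<open>n\<close>.\<close>

lemma not_weakly_separated_compl:
  assumes "n \<ge> 4" "i \<in> {2..n - 1}"
  shows "\<not> weakly_separated {i} ({1..n} - {i})"
proof
  assume "weakly_separated {i} ({1..n} - {i})"
  moreover have "card ({1..n} - {i}) = n - 1" using assms by auto
  ultimately have "precedes ({1..n} - {i}) {i} \<or> precedes {i} ({1..n} - {i})"
    using assms by (intro weakly_separated_singletonD) auto
  moreover have "1 \<in> {1..n} - {i}" "n \<in> {1..n} - {i}" using assms by auto
  ultimately have "n < i \<or> i < 1" unfolding precedes_def by blast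
  then show False using assms by auto
qed

lemma clique_not_compl:
  assumes "n \<ge> 4" "pairwise weakly_separated W" "i \<in> {2..n - 1}" "{i} \<in> W"
  shows "{1..n} - {i} \<notin> W"
proof
  assume "{1..n} - {i} \<in> W"
  moreover have "1 \<in> {1..n} - {i}" "1 \<notin> {i}" using assms by auto
  then have "{i} \<noteq> {1..n} - {i}" by metis
  ultimately show False
    using assms not_weakly_separated_compl[OF assms(1,3)] by (auto simp: pairwise_def)
qed

lemma singleton_extreme: "n \<ge> 4 \<Longrightarrow> {i} \<in> extreme_sets n \<Longrightarrow> i \<in> {2..n - 1}"
proof -
  assume n: "n \<ge> 4" and "{i} \<in> extreme_sets n"
  then obtain j where j: "j \<in> {2..n - 1}" "{i} = {j} \<or> {i} = {1..n} - {j}"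
    by (auto simp: extreme_sets_def)
  have "{i} \<noteq> {1..n} - {j}"
  proof
    assume "{i} = {1..n} - {j}"
    moreover have "1 \<in> {1..n} - {j}" "n \<in> {1..n} - {j}" using j(1) by auto
    ultimately have "1 = i" "n = i" by blast+
    then show False using n by simp
  qed
  then show "i \<in> {2..n - 1}" using j by auto
qed

lemma apexes_nonempty_no_two:
  assumes n: "n \<ge> 4" and W: "W \<subseteq> extreme_sets n" "pairwise weakly_separated W" and two: "{2} \<notin> W"
  shows "apexes (nonfrozen_sets n) weakly_separated (extreme_sets n) W \<noteq> {}"
proof (cases "\<exists>i. {i} \<in> W")
  case True
  define i where "i = (LEAST i. {i} \<in> W)"
  have i: "{i} \<in> W" unfolding i_def using True by (rule LeastI_ex)
  then have "i \<in> {2..n - 1}" using singleton_extreme[OF n] W(1) by blast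
  moreover have "i \<noteq> 2" using i two by auto
  moreover have "i \<le> j" if "{j} \<in> W" for j unfolding i_def using that by (rule Least_le)
  ultimately show ?thesis
    using pair_in_apexes[OF n W(1), of i] clique_not_compl[OF n W(2) _ i] i by fastforce
next
  case False
  \<comment> \<open>For the default \<open>i = n\<close>, the complement excluded from
    \<open>W\<close> is a frozen initial segment.\<close>
  have "{1..n} - {n} \<notin> extreme_sets n"
  proof
    assume "{1..n} - {n} \<in> extreme_sets n"
    then have "\<not> frozen n ({1..n} - {n})" using extreme_nonfrozen by (auto simp: nonfrozen_sets_def)
    moreover have "{1..n} - {n} = {1..n - 1}" using n by auto
    ultimately show False unfolding frozen_iff using diff_le_self by metis
  qed
  then show ?thesis using pair_in_apexes[OF n W(1), of n] False W(1) n by fastforce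
qed

section \<open>Symmetries of the extreme sets\<close>

lemma sym_group_nonfrozen:
  assumes "g \<in> carrier (sym_group n)" "A \<in> nonfrozen_sets n"
  shows "g A \<in> nonfrozen_sets n"
proof -
  have "{A} \<in> Delta_ws_hat n"
    using assms(2) by (simp add: Delta_ws_hat_def clique_complex_def nonfrozen_sets_def)
  then have "g ` {A} \<in> Delta_ws_hat n" by (rule sym_group_simplicial[OF assms(1)])
  then show ?thesis by (simp add: Delta_ws_hat_def clique_complex_def nonfrozen_sets_def)
qed

lemma sym_group_extreme:
  assumes g: "g \<in> carrier (sym_group n)" and A: "A \<in> extreme_sets n"
  shows "g A \<in> extreme_sets n"
proof -
  have sub: "A \<subseteq> {1..n}" if "A \<in> extreme_sets n" for A
    using that extreme_nonfrozen by (auto simp: nonfrozen_sets_def)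
  have a: "alpha n A \<in> extreme_sets n" if "A \<in> extreme_sets n" for A
  proof -
    obtain i where i: "i \<in> {2..n - 1}" "A = {i} \<or> A = {1..n} - {i}"
      using \<open>A \<in> extreme_sets n\<close> by (auto simp: extreme_sets_def)
    then have "{i} \<subseteq> {1..n}" by auto
    then have "alpha n A = {1..n} - {i} \<or> alpha n A = {i}"
      using i(2) by (auto simp: alpha_def)
    then show ?thesis using i(1) unfolding extreme_sets_def by blast
  qed
  have w1: "w0 n {i} \<in> extreme_sets n" if "i \<in> {2..n - 1}" for i
  proof -
    have "w0 n {i} = {n + 1 - i}" using that by (auto simp: w0_def)
    moreover have "n + 1 - i \<in> {2..n - 1}" using that by auto
    ultimately show ?thesis unfolding extreme_sets_def by blast
  qed
  have w: "w0 n A \<in> extreme_sets n" if "A \<in> extreme_sets n" for A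
  proof -
    obtain i where i: "i \<in> {2..n - 1}" "A = {i} \<or> A = {1..n} - {i}"
      using \<open>A \<in> extreme_sets n\<close> by (auto simp: extreme_sets_def)
    have "{i} \<subseteq> {1..n}" using i by auto
    \<comment> \<open>Commuting \<open>w0\<close> with \<open>alpha\<close> reduces complements to
      singletons.\<close>
    then have "{1..n} - {i} = alpha n {i}" "w0 n (alpha n {i}) = alpha n (w0 n {i})"
      using w0_alpha by (auto simp: alpha_def)
    then show ?thesis using i w1 a by metis
  qed
  have P: "A \<in> Pow {1..n}" using sub[OF A] by auto
  show ?thesis
    using g a[OF A] w[OF A] a[OF w[OF A]] A P unfolding carrier_sym_group
    by (elim insertE emptyE) (simp_all only: compose_eq[OF P] restrict_apply' P)
qed

lemma sym_group_flag_complex_action: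
  "flag_complex_action (nonfrozen_sets n) weakly_separated (extreme_sets n) (sym_group n)"
proof
  have sub: "nonfrozen_sets n \<subseteq> Pow {1..n}" by (auto simp: nonfrozen_sets_def)
  then show "finite (nonfrozen_sets n)" by (rule finite_subset) simp
  show "weakly_separated A A" for A by (rule weakly_separated_subset) simp
  show "weakly_separated A B \<Longrightarrow> weakly_separated B A" for A B
    by (simp add: weakly_separated_commute)
  show "extreme_sets n \<subseteq> nonfrozen_sets n" by (rule extreme_nonfrozen)
  fix g assume g: "g \<in> carrier (sym_group n)"
  have inv: "g (g A) = A" if "A \<in> nonfrozen_sets n" for A
    using sym_group_app(2)[OF g] that sub by blast
  show "bij_betw g (nonfrozen_sets n) (nonfrozen_sets n)"
    by (rule bij_betw_byWitness[where f' = g]) (use inv sym_group_nonfrozen[OF g] in auto)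
  show "weakly_separated (g A) (g B) \<longleftrightarrow> weakly_separated A B"
    if "A \<in> nonfrozen_sets n" "B \<in> nonfrozen_sets n" for A B
    using sym_group_weakly_separated[OF g] that sub by blast
  show "g ` extreme_sets n = extreme_sets n"
  proof
    show "g ` extreme_sets n \<subseteq> extreme_sets n" using sym_group_extreme[OF g] by blast
    show "extreme_sets n \<subseteq> g ` extreme_sets n"
    proof
      fix A assume A: "A \<in> extreme_sets n"
      then have "A = g (g A)" using inv extreme_nonfrozen by (metis subsetD)
      then show "A \<in> g ` extreme_sets n" using sym_group_extreme[OF g A] by (rule image_eqI)
    qed
  qed
qed

lemma apexes_nonempty_extreme:
  assumes n: "n \<ge> 4" and W: "W \<subseteq> extreme_sets n" "pairwise weakly_separated W"
  shows "apexes (nonfrozen_sets n) weakly_separated (extreme_sets n) W \<noteq> {}"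
proof (cases "{2} \<in> W")
  case False
  then show ?thesis using apexes_nonempty_no_two n W by blast
next
  case True
  interpret flag_complex_action "nonfrozen_sets n" weakly_separated "extreme_sets n" "sym_group n"
    by (rule sym_group_flag_complex_action)
  have a: "alpha n \<in> carrier (sym_group n)" by (simp add: carrier_sym_group)
  have subW: "A \<subseteq> {1..n}" if "A \<in> W" for A
    using that W(1) extreme_nonfrozen by (auto simp: nonfrozen_sets_def)
  have "{1..n} - {2} \<notin> W" using clique_not_compl[OF n W(2) _ True] n by auto
  have "{2} \<notin> alpha n ` W"
  proof
    assume "{2} \<in> alpha n ` W"
    then obtain A where A: "A \<in> W" "alpha n A = {2}" by blast
    then have "A = {1..n} - {2}"
      using alpha_alpha[OF subW[OF A(1)]] n by (auto simp: alpha_def)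
    then show False using A(1) \<open>{1..n} - {2} \<notin> W\<close> by blast
  qed
  moreover have "alpha n ` W \<subseteq> extreme_sets n" using sym_group_extreme[OF a] W(1) by blast
  moreover have "pairwise weakly_separated (alpha n ` W)"
  proof (unfold pairwise_image, rule pairwiseI, rule impI)
    fix A B assume "A \<in> W" "B \<in> W" "A \<noteq> B"
    then show "weakly_separated (alpha n A) (alpha n B)"
      using W(2) weakly_separated_alpha[OF subW subW] by (auto simp: pairwise_def)
  qed
  ultimately obtain A where A: "A \<in> apexes (nonfrozen_sets n) weakly_separated (extreme_sets n) (alpha n ` W)"
    using apexes_nonempty_no_two[OF n] by blast
  then have "A \<in> nonfrozen_sets n" by (simp add: apexes_def)
  \<comment> \<open>As \<open>alpha n\<close> is an involution, the apex \<open>A\<close> of the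
    image family is the image of \<open>alpha n A\<close>, which is therefore an apex of
    \<open>W\<close>.\<close>
  then have "alpha n A \<in> nonfrozen_sets n" "alpha n (alpha n A) = A"
    using sym_group_nonfrozen[OF a] alpha_alpha by (auto simp: nonfrozen_sets_def)
  then show ?thesis
    using A apexes_invariant[OF a, of "alpha n A" W] subset_trans[OF W(1) extreme_nonfrozen] by auto
qed

end

theorem theorem1p1:
  fixes n :: nat
  assumes "n \<ge> 4"
  shows "G_contractible (sym_group n) (realization (Delta_ws_hat n)) (sym_action n)"
proof -
  interpret flag_complex_apexes "nonfrozen_sets n" weakly_separated "extreme_sets n" "sym_group n"
    using sym_group_flag_complex_action apexes_nonempty_extreme[OF assms]
    by (intro flag_complex_apexes.intro flag_complex_apexes_axioms.intro)
  have "Delta_ws_hat n = K" by (simp add: Delta_ws_hat_def nonfrozen_sets_def)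
  moreover have "sym_action n = realization_map (Delta_ws_hat n)"
    by (simp add: sym_action_def fun_eq_iff)
  ultimately show ?thesis
    using G_contractible_flag_complex G_space_Delta_ws_hat[of n] by simp
qed

end
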